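(* Let $T$ be an additive ternary $\Gamma$-ring; write $\mathcal A=\mathcal A(T,\Gamma)$, $\mathcal R=\mathcal R_T$ for its regular operator ring, and $K$ for its unital regular defect. Assume that $K^2=0$ and that the quotient map $\mathcal A\twoheadrightarrow\mathcal R$ admits a unital additive section, i.e. an additive section $s:\mathcal R\to\mathcal A$ with $s(1_{\mathcal R})=1_{\mathcal A}$. For such a section put $\omega_s(r,r')=s(r)s(r')-s(rr')\in K$. Then $\omega_s$ is a normalized Hochschild $2$-cocycle, and its cohomology class $$\Omega(T,\Gamma)=[\omega_s]\in\operatorname{HH}^2_{\mathbb Z}(\mathcal R_T,K)$$ is independent of the unital additive section $s$. Moreover, the following are equivalent: (i) $\Omega(T,\Gamma)=0$; (ii) the quotient $\mathcal A(T,\Gamma)\twoheadrightarrow\mathcal R_T$ admits a unital ring section; (iii) the extension $0\to K\to\mathcal A\to\mathcal R_T\to0$ is equivalent to the split square-zero extension $\mathcal R_T\ltimes K$.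
   Context: An additive ternary $\Gamma$-ring consists of abelian groups $(T,+)$, $(\Gamma,+)$ and a map $T\times\Gamma\times T\times\Gamma\times T\to T$, $(x,\alpha,y,\beta,z)\mapsto x\alpha y\beta z$, additive in each of the five variables, with $(x\alpha y\beta z)\gamma u\delta v=x\alpha(y\beta z\gamma u)\delta v=x\alpha y\beta(z\gamma u\delta v)$. Let $F(T,\Gamma)=T\otimes_{\mathbb Z}\Gamma\otimes_{\mathbb Z}T\otimes_{\mathbb Z}\Gamma$ with the associative bilinear multiplication $(a\otimes\alpha\otimes b\otimes\beta)(c\otimes\gamma\otimes d\otimes\delta)=(a\alpha b\beta c)\otimes\gamma\otimes d\otimes\delta$, let $J(T,\Gamma)$ be the two-sided ideal generated by all $(a\alpha b\beta c)\otimes\gamma\otimes d\otimes\delta-a\otimes\alpha\otimes(b\beta c\gamma d)\otimes\delta$, and let $\mathcal O(T,\Gamma)=F(T,\Gamma)/J(T,\Gamma)$; $[a,\alpha,b,\beta]$ is the class of a pure tensor. The unital ring $\mathcal A(T,\Gamma)=\mathbb Z\ltimes\mathcal O(T,\Gamma)$ is $\mathbb Z\oplus\mathcal O(T,\Gamma)$ with $(n,r)(m,s)=(nm,ns+mr+rs)$. The regular representation is $\rho_T:\mathcal O(T,\Gamma)\to\operatorname{End}_{\mathbb Z}(T)$, $\rho_T([a,\alpha,b,\beta])(x)=a\alpha b\beta x$, and its unital extension is $\widehat\rho_T:\mathcal A(T,\Gamma)\to\operatorname{End}_{\mathbb Z}(T)$, $\widehat\rho_T(n,u)=n\operatorname{id}_T+\rho_T(u)$.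 The unital regular defect is $K=\ker\widehat\rho_T$ and the regular operator ring is $\mathcal R_T=\operatorname{im}\widehat\rho_T\cong\mathcal A/K$. When $K^2=0$, $K$ is naturally an $\mathcal R_T$-bimodule via lifts to $\mathcal A$. $\operatorname{HH}^*_{\mathbb Z}$ is Hochschild cohomology over $\mathbb Z$ computed by the standard Hochschild cochain complex $\operatorname{Hom}_{\mathbb Z}(\mathcal R^{\otimes n},K)$; the $2$-cocycle identity is $r\omega(r',r'')-\omega(rr',r'')+\omega(r,r'r'')-\omega(r,r')r''=0$, and normalized means $\omega$ vanishes when one argument is $1_{\mathcal R}$. The split square-zero extension $\mathcal R\ltimes K$ is $\mathcal R\oplus K$ with $(r,k)(r',k')=(rr',rk'+kr')$. Two extensions of $\mathcal R$ by $K$ are equivalent if there is a unital ring isomorphism between them inducing the identity on $K$ and on $\mathcal R$. *)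

theory Defs
  imports Complex_Main "HOL-Algebra.QuotRing" "HOL-Algebra.Ideal_Product" "HOL-Algebra.Free_Abelian_Groups"
begin

text \<open>
  The abelian groups \<open>T\<close> and \<open>\<Gamma>\<close> are the types \<open>'t\<close> and \<open>'g\<close>;
  \<open>tri x \<alpha> y \<beta> z\<close> is the product written \<open>x\<alpha>y\<beta>z\<close>.
\<close>

type_synonym ('t, 'g) ternary = "'t \<Rightarrow> 'g \<Rightarrow> 't \<Rightarrow> 'g \<Rightarrow> 't \<Rightarrow> 't"

locale ternary_gamma_ring =
  fixes tri :: "('t::ab_group_add, 'g::ab_group_add) ternary"
  assumes additive_1: "Modules.additive (\<lambda>x. tri x \<alpha> y \<beta> z)"
    and additive_2: "Modules.additive (\<lambda>\<alpha>. tri x \<alpha> y \<beta> z)"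
    and additive_3: "Modules.additive (\<lambda>y. tri x \<alpha> y \<beta> z)"
    and additive_4: "Modules.additive (\<lambda>\<beta>. tri x \<alpha> y \<beta> z)"
    and additive_5: "Modules.additive (\<lambda>z. tri x \<alpha> y \<beta> z)"
    and assoc_left: "tri (tri x \<alpha> y \<beta> z) \<gamma> u \<delta> v = tri x \<alpha> (tri y \<beta> z \<gamma> u) \<delta> v"
    and assoc_right: "tri x \<alpha> (tri y \<beta> z \<gamma> u) \<delta> v = tri x \<alpha> y \<beta> (tri z \<gamma> u \<delta> v)"

text \<open>
  The rings \<open>F\<close> and \<open>\<O>\<close> below have no unit. They are encoded as \<open>ring\<close> records whose
  \<open>one\<close> field carries no meaning and is never used. The library's \<open>ideal\<close> and \<open>genideal\<close>
  presuppose a unital ring, so the non-unital versions are given here; the quotient \<open>Quot\<close>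
  is the library's, its carrier, addition and multiplication not involving \<open>one\<close>.
\<close>

definition rng_ideal :: "('a, 'm) ring_scheme \<Rightarrow> 'a set \<Rightarrow> bool" where
  "rng_ideal R I \<longleftrightarrow> additive_subgroup I R \<and>
     (\<forall>x\<in>carrier R. \<forall>a\<in>I. x \<otimes>\<^bsub>R\<^esub> a \<in> I \<and> a \<otimes>\<^bsub>R\<^esub> x \<in> I)"

definition rng_genideal :: "('a, 'm) ring_scheme \<Rightarrow> 'a set \<Rightarrow> 'a set" where
  "rng_genideal R S = \<Inter>{I. rng_ideal R I \<and> S \<subseteq> I}"

text \<open>
  \<open>F\<close> is the quotient of the free abelian group on quadruples by the multilinearity
  relations, i.e. the fourfold tensor product over the integers. Its multiplication is induced
  from the biadditive extension of the product of quadruples to the free abelian group.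
\<close>

type_synonym ('t, 'g) free4 = "('t \<times> 'g \<times> 't \<times> 'g) \<Rightarrow>\<^sub>0 int"

fun quad_mult ::
  "('t, 'g) ternary \<Rightarrow> 't \<times> 'g \<times> 't \<times> 'g \<Rightarrow> 't \<times> 'g \<times> 't \<times> 'g \<Rightarrow> 't \<times> 'g \<times> 't \<times> 'g" where
  "quad_mult tri (a, \<alpha>, b, \<beta>) (c, \<gamma>, d, \<delta>) = (tri a \<alpha> b \<beta> c, \<gamma>, d, \<delta>)"

definition free_rng :: "('t::ab_group_add, 'g::ab_group_add) ternary \<Rightarrow> ('t, 'g) free4 ring" where
  "free_rng tri =
    \<lparr>carrier = UNIV,
     monoid.mult = (\<lambda>v w. frag_extend (\<lambda>p. frag_extend (\<lambda>q. frag_of (quad_mult tri p q)) w) v),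
     one = 0, ring.zero = 0, ring.add = (+)\<rparr>"

definition multilin_rels :: "('t::ab_group_add, 'g::ab_group_add) free4 set" where
  "multilin_rels =
     {frag_of (a + a', \<alpha>, b, \<beta>) - frag_of (a, \<alpha>, b, \<beta>) - frag_of (a', \<alpha>, b, \<beta>) | a a' \<alpha> b \<beta>. True}
   \<union> {frag_of (a, \<alpha> + \<alpha>', b, \<beta>) - frag_of (a, \<alpha>, b, \<beta>) - frag_of (a, \<alpha>', b, \<beta>) | a \<alpha> \<alpha>' b \<beta>. True}
   \<union> {frag_of (a, \<alpha>, b + b', \<beta>) - frag_of (a, \<alpha>, b, \<beta>) - frag_of (a, \<alpha>, b', \<beta>) | a \<alpha> b b' \<beta>. True}
   \<union> {frag_of (a, \<alpha>, b, \<beta> + \<beta>') - frag_of (a, \<alpha>, b, \<beta>) - frag_of (a, \<alpha>, b, \<beta>') | a \<alpha> b \<beta> \<beta>'. True}"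

definition multilin_subgroup :: "('t::ab_group_add, 'g::ab_group_add) free4 set" where
  "multilin_subgroup = generate (free_Abelian_group UNIV) multilin_rels"

definition F_rng :: "('t::ab_group_add, 'g::ab_group_add) ternary \<Rightarrow> ('t, 'g) free4 set ring" where
  "F_rng tri = free_rng tri Quot multilin_subgroup"

definition pure_tensor ::
  "('t::ab_group_add, 'g::ab_group_add) ternary \<Rightarrow> 't \<Rightarrow> 'g \<Rightarrow> 't \<Rightarrow> 'g \<Rightarrow> ('t, 'g) free4 set" where
  "pure_tensor tri a \<alpha> b \<beta> = multilin_subgroup +>\<^bsub>free_rng tri\<^esub> frag_of (a, \<alpha>, b, \<beta>)"

definition J_ideal :: "('t::ab_group_add, 'g::ab_group_add) ternary \<Rightarrow> ('t, 'g) free4 set set" where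
  "J_ideal tri = rng_genideal (F_rng tri)
     {pure_tensor tri (tri a \<alpha> b \<beta> c) \<gamma> d \<delta> \<ominus>\<^bsub>F_rng tri\<^esub> pure_tensor tri a \<alpha> (tri b \<beta> c \<gamma> d) \<delta>
       | a \<alpha> b \<beta> c \<gamma> d \<delta>. True}"

definition O_rng :: "('t::ab_group_add, 'g::ab_group_add) ternary \<Rightarrow> ('t, 'g) free4 set set ring" where
  "O_rng tri = F_rng tri Quot J_ideal tri"

definition A_ring ::
  "('t::ab_group_add, 'g::ab_group_add) ternary \<Rightarrow> (int \<times> ('t, 'g) free4 set set) ring" where
  "A_ring tri =
    \<lparr>carrier = UNIV \<times> carrier (O_rng tri),
     monoid.mult = (\<lambda>(n, r) (m, s).
       (n * m, [n] \<cdot>\<^bsub>O_rng tri\<^esub> s \<oplus>\<^bsub>O_rng tri\<^esub> [m] \<cdot>\<^bsub>O_rng tri\<^esub> r \<oplus>\<^bsub>O_rng tri\<^esub> r \<otimes>\<^bsub>O_rng tri\<^esub> s)),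
     one = (1, \<zero>\<^bsub>O_rng tri\<^esub>),
     ring.zero = (0, \<zero>\<^bsub>O_rng tri\<^esub>),
     ring.add = (\<lambda>(n, r) (m, s). (n + m, r \<oplus>\<^bsub>O_rng tri\<^esub> s))\<rparr>"

definition End_ring :: "('t::ab_group_add \<Rightarrow> 't) ring" where
  "End_ring =
    \<lparr>carrier = {f. Modules.additive f}, monoid.mult = (\<circ>), one = id,
     ring.zero = (\<lambda>_. 0), ring.add = (\<lambda>f g x. f x + g x)\<rparr>"

text \<open>
  \<open>rho\<close> is obtained from the additive map on the free abelian group with value
  \<open>x \<mapsto> a\<alpha>b\<beta>x\<close> on the quadruple \<open>(a,\<alpha>,b,\<beta>)\<close> by passing to the two successive quotients
  defining \<open>\<O>\<close>; \<open>the_elem\<close> picks the common value on a coset.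
\<close>

definition rho_free ::
  "('t::ab_group_add, 'g::ab_group_add) ternary \<Rightarrow> ('t, 'g) free4 \<Rightarrow> 't \<Rightarrow> 't" where
  "rho_free tri w =
     (\<Oplus>\<^bsub>End_ring\<^esub> p\<in>Poly_Mapping.keys w.
        [Poly_Mapping.lookup w p] \<cdot>\<^bsub>End_ring\<^esub> (case p of (a, \<alpha>, b, \<beta>) \<Rightarrow> tri a \<alpha> b \<beta>))"

definition rho_F ::
  "('t::ab_group_add, 'g::ab_group_add) ternary \<Rightarrow> ('t, 'g) free4 set \<Rightarrow> 't \<Rightarrow> 't" where
  "rho_F tri V = the_elem (rho_free tri ` V)"

definition rho ::
  "('t::ab_group_add, 'g::ab_group_add) ternary \<Rightarrow> ('t, 'g) free4 set set \<Rightarrow> 't \<Rightarrow> 't" where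
  "rho tri U = the_elem (rho_F tri ` U)"

definition rho_hat ::
  "('t::ab_group_add, 'g::ab_group_add) ternary \<Rightarrow> int \<times> ('t, 'g) free4 set set \<Rightarrow> 't \<Rightarrow> 't" where
  "rho_hat tri = (\<lambda>(n, u). [n] \<cdot>\<^bsub>End_ring\<^esub> \<one>\<^bsub>End_ring\<^esub> \<oplus>\<^bsub>End_ring\<^esub> rho tri u)"

definition defect ::
  "('t::ab_group_add, 'g::ab_group_add) ternary \<Rightarrow> (int \<times> ('t, 'g) free4 set set) set" where
  "defect tri = a_kernel (A_ring tri) End_ring (rho_hat tri)"

definition R_ring :: "('t::ab_group_add, 'g::ab_group_add) ternary \<Rightarrow> ('t \<Rightarrow> 't) ring" where
  "R_ring tri = End_ring\<lparr>carrier := rho_hat tri ` carrier (A_ring tri)\<rparr>"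

text \<open>As for the library's \<open>module\<close>, the \<open>mult\<close> and \<open>one\<close> fields of a bimodule are irrelevant.\<close>

record ('a, 'b) bimodule = "'b ring" +
  lact :: "'a \<Rightarrow> 'b \<Rightarrow> 'b"
  ract :: "'b \<Rightarrow> 'a \<Rightarrow> 'b"

text \<open>
  \<open>r k\<close> is the common value of \<open>a \<otimes> k\<close> over all lifts \<open>a\<close> of \<open>r\<close> to \<open>A\<close>, and similarly on
  the right; this is well defined when the defect has square zero.
\<close>

definition defect_bimodule ::
  "('t::ab_group_add, 'g::ab_group_add) ternary \<Rightarrow> ('t \<Rightarrow> 't, int \<times> ('t, 'g) free4 set set) bimodule" where
  "defect_bimodule tri =
    \<lparr>carrier = defect tri, monoid.mult = monoid.mult (A_ring tri), one = \<zero>\<^bsub>A_ring tri\<^esub>,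
     ring.zero = \<zero>\<^bsub>A_ring tri\<^esub>, ring.add = ring.add (A_ring tri),
     lact = (\<lambda>r k. the_elem ((\<lambda>a. a \<otimes>\<^bsub>A_ring tri\<^esub> k) ` {a \<in> carrier (A_ring tri). rho_hat tri a = r})),
     ract = (\<lambda>k r. the_elem ((\<lambda>a. k \<otimes>\<^bsub>A_ring tri\<^esub> a) ` {a \<in> carrier (A_ring tri). rho_hat tri a = r}))\<rparr>"

definition tuples :: "('a, 'm) ring_scheme \<Rightarrow> nat \<Rightarrow> 'a list set" where
  "tuples R n = {xs. length xs = n \<and> set xs \<subseteq> carrier R}"

text \<open>
  An element of \<open>Hom(R^{\<otimes>n}, M)\<close> is a map on \<open>n\<close>-tuples that is additive in each entry.
\<close>

definition cochains :: "('a, 'm) ring_scheme \<Rightarrow> ('a, 'b, 'n) bimodule_scheme \<Rightarrow> nat \<Rightarrow> ('a list \<Rightarrow> 'b) set" where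
  "cochains R M n =
    {f \<in> tuples R n \<rightarrow>\<^sub>E carrier M.
       \<forall>xs\<in>tuples R n. \<forall>i<n. \<forall>x\<in>carrier R. \<forall>y\<in>carrier R.
         f (xs[i := x \<oplus>\<^bsub>R\<^esub> y]) = f (xs[i := x]) \<oplus>\<^bsub>M\<^esub> f (xs[i := y])}"

definition cochain_group ::
  "('a, 'm) ring_scheme \<Rightarrow> ('a, 'b, 'n) bimodule_scheme \<Rightarrow> nat \<Rightarrow> ('a list \<Rightarrow> 'b) monoid" where
  "cochain_group R M n =
    \<lparr>carrier = cochains R M n,
     monoid.mult = (\<lambda>f g. \<lambda>xs\<in>tuples R n. f xs \<oplus>\<^bsub>M\<^esub> g xs),
     one = (\<lambda>xs\<in>tuples R n. \<zero>\<^bsub>M\<^esub>)\<rparr>"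

definition hochschild_d ::
  "('a, 'm) ring_scheme \<Rightarrow> ('a, 'b, 'n) bimodule_scheme \<Rightarrow> nat \<Rightarrow> ('a list \<Rightarrow> 'b) \<Rightarrow> 'a list \<Rightarrow> 'b" where
  "hochschild_d R M n f =
    (\<lambda>xs\<in>tuples R (Suc n).
       lact M (hd xs) (f (tl xs))
       \<oplus>\<^bsub>M\<^esub> (\<Oplus>\<^bsub>M\<^esub> i\<in>{..<n}. [((- 1 :: int) ^ Suc i)] \<cdot>\<^bsub>M\<^esub>
              f (take i xs @ (xs ! i \<otimes>\<^bsub>R\<^esub> xs ! Suc i) # drop (Suc (Suc i)) xs))
       \<oplus>\<^bsub>M\<^esub> [((- 1 :: int) ^ Suc n)] \<cdot>\<^bsub>M\<^esub> ract M (f (butlast xs)) (last xs))"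

definition cocycles :: "('a, 'm) ring_scheme \<Rightarrow> ('a, 'b, 'n) bimodule_scheme \<Rightarrow> nat \<Rightarrow> ('a list \<Rightarrow> 'b) set" where
  "cocycles R M n = kernel (cochain_group R M n) (cochain_group R M (Suc n)) (hochschild_d R M n)"

fun coboundaries :: "('a, 'm) ring_scheme \<Rightarrow> ('a, 'b, 'n) bimodule_scheme \<Rightarrow> nat \<Rightarrow> ('a list \<Rightarrow> 'b) set" where
  "coboundaries R M 0 = {\<one>\<^bsub>cochain_group R M 0\<^esub>}"
| "coboundaries R M (Suc n) = hochschild_d R M n ` cochains R M n"

definition cocycle_group ::
  "('a, 'm) ring_scheme \<Rightarrow> ('a, 'b, 'n) bimodule_scheme \<Rightarrow> nat \<Rightarrow> ('a list \<Rightarrow> 'b) monoid" where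
  "cocycle_group R M n = (cochain_group R M n)\<lparr>carrier := cocycles R M n\<rparr>"

definition HH ::
  "('a, 'm) ring_scheme \<Rightarrow> ('a, 'b, 'n) bimodule_scheme \<Rightarrow> nat \<Rightarrow> ('a list \<Rightarrow> 'b) set monoid" where
  "HH R M n = cocycle_group R M n Mod coboundaries R M n"

definition HH_class ::
  "('a, 'm) ring_scheme \<Rightarrow> ('a, 'b, 'n) bimodule_scheme \<Rightarrow> nat \<Rightarrow> ('a list \<Rightarrow> 'b) \<Rightarrow> ('a list \<Rightarrow> 'b) set" where
  "HH_class R M n f = coboundaries R M n #>\<^bsub>cocycle_group R M n\<^esub> f"

definition normalized ::
  "('a, 'm) ring_scheme \<Rightarrow> ('a, 'b, 'n) bimodule_scheme \<Rightarrow> nat \<Rightarrow> ('a list \<Rightarrow> 'b) \<Rightarrow> bool" where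
  "normalized R M n f \<longleftrightarrow> (\<forall>xs\<in>tuples R n. \<one>\<^bsub>R\<^esub> \<in> set xs \<longrightarrow> f xs = \<zero>\<^bsub>M\<^esub>)"

definition split_extension ::
  "('a, 'm) ring_scheme \<Rightarrow> ('a, 'b, 'n) bimodule_scheme \<Rightarrow> ('a \<times> 'b) ring" where
  "split_extension R M =
    \<lparr>carrier = carrier R \<times> carrier M,
     monoid.mult = (\<lambda>(r, k) (r', k'). (r \<otimes>\<^bsub>R\<^esub> r', lact M r k' \<oplus>\<^bsub>M\<^esub> ract M k r')),
     one = (\<one>\<^bsub>R\<^esub>, \<zero>\<^bsub>M\<^esub>),
     ring.zero = (\<zero>\<^bsub>R\<^esub>, \<zero>\<^bsub>M\<^esub>),
     ring.add = (\<lambda>(r, k) (r', k'). (r \<oplus>\<^bsub>R\<^esub> r', k \<oplus>\<^bsub>M\<^esub> k'))\<rparr>"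

text \<open>
  An extension of \<open>R\<close> by \<open>K\<close> is given as \<open>(E, i, p)\<close> with \<open>i\<close> the inclusion of \<open>K\<close> and \<open>p\<close> the
  projection onto \<open>R\<close>.
\<close>

definition equivalent_extensions ::
  "'k set \<Rightarrow> 'e ring \<times> ('k \<Rightarrow> 'e) \<times> ('e \<Rightarrow> 'r) \<Rightarrow> 'f ring \<times> ('k \<Rightarrow> 'f) \<times> ('f \<Rightarrow> 'r) \<Rightarrow> bool" where
  "equivalent_extensions K = (\<lambda>(E, i, p) (E', i', p').
     \<exists>\<phi>\<in>ring_iso E E'. (\<forall>k\<in>K. \<phi> (i k) = i' k) \<and> (\<forall>e\<in>carrier E. p' (\<phi> e) = p e))"

definition unital_additive_section ::
  "('t::ab_group_add, 'g::ab_group_add) ternary \<Rightarrow> (('t \<Rightarrow> 't) \<Rightarrow> int \<times> ('t, 'g) free4 set set) \<Rightarrow> bool" where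
  "unital_additive_section tri s \<longleftrightarrow>
     s \<in> hom (add_monoid (R_ring tri)) (add_monoid (A_ring tri)) \<and>
     (\<forall>r\<in>carrier (R_ring tri). rho_hat tri (s r) = r) \<and>
     s \<one>\<^bsub>R_ring tri\<^esub> = \<one>\<^bsub>A_ring tri\<^esub>"

definition unital_ring_section ::
  "('t::ab_group_add, 'g::ab_group_add) ternary \<Rightarrow> (('t \<Rightarrow> 't) \<Rightarrow> int \<times> ('t, 'g) free4 set set) \<Rightarrow> bool" where
  "unital_ring_section tri s \<longleftrightarrow>
     s \<in> ring_hom (R_ring tri) (A_ring tri) \<and>
     (\<forall>r\<in>carrier (R_ring tri). rho_hat tri (s r) = r)"

definition omega ::
  "('t::ab_group_add, 'g::ab_group_add) ternary \<Rightarrow> (('t \<Rightarrow> 't) \<Rightarrow> int \<times> ('t, 'g) free4 set set) \<Rightarrow>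
     ('t \<Rightarrow> 't) list \<Rightarrow> int \<times> ('t, 'g) free4 set set" where
  "omega tri s = (\<lambda>xs\<in>tuples (R_ring tri) 2.
     s (xs ! 0) \<otimes>\<^bsub>A_ring tri\<^esub> s (xs ! 1) \<ominus>\<^bsub>A_ring tri\<^esub> s (xs ! 0 \<otimes>\<^bsub>R_ring tri\<^esub> xs ! 1))"

text \<open>The common class of all \<open>omega tri s\<close>; a section must exist for this to be meaningful.\<close>

definition Omega ::
  "('t::ab_group_add, 'g::ab_group_add) ternary \<Rightarrow> (('t \<Rightarrow> 't) list \<Rightarrow> int \<times> ('t, 'g) free4 set set) set" where
  "Omega tri = (THE c. \<exists>s. unital_additive_section tri s \<and>
     c = HH_class (R_ring tri) (defect_bimodule tri) 2 (omega tri s))"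

end

theory Submission
  imports Defs
begin

text \<open>
  Since \<open>K\<^sup>2 = 0\<close>, replacing a unital additive section \<open>s\<close> by \<open>s + f\<close> with \<open>f : R \<rightarrow> K\<close> additive changes the
  factor set \<open>\<omega>\<^sub>s\<close> by exactly the coboundary \<open>d f\<close>: the quadratic term \<open>f(r) f(r')\<close> vanishes. As any two
  sections differ by such an \<open>f\<close>, the class of \<open>\<omega>\<^sub>s\<close> is independent of \<open>s\<close>; and if \<open>\<omega>\<^sub>s = d g\<close>, then \<open>s - g\<close>
  has factor set \<open>0\<close>, i.e. is multiplicative (and unital, because \<open>\<omega>\<^sub>s\<close> is normalized). A ring section
  \<open>t\<close> gives the splitting \<open>a \<mapsto> (p a, a - t (p a))\<close>, and a splitting \<open>\<phi>\<close> gives the ring section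
  \<open>r \<mapsto> \<phi>\<^sup>-\<^sup>1 (r, 0)\<close>. All this holds for any surjective ring homomorphism \<open>p\<close> with square-zero
  kernel, so what remains is that the tensor construction really yields a ring \<open>\<A>\<close> and a ring
  homomorphism to the endomorphisms of \<open>T\<close>.
\<close>

section \<open>Rings without unit\<close>

text \<open>The rings \<open>F_rng\<close> and \<open>O_rng\<close> have no unit, and only
  \<open>A_ring\<close> acquires one; ideals, quotients and homomorphisms therefore have to be
  handled without \<open>one\<close>.\<close>

locale rng = abelian_group R for R (structure) +
  assumes m_closed [intro, simp]: "\<lbrakk>x \<in> carrier R; y \<in> carrier R\<rbrakk> \<Longrightarrow> x \<otimes> y \<in> carrier R"
    and m_assoc: "\<lbrakk>x \<in> carrier R; y \<in> carrier R; z \<in> carrier R\<rbrakk> \<Longrightarrow> (x \<otimes> y) \<otimes> z = x \<otimes> (y \<otimes> z)"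
    and l_distr: "\<lbrakk>x \<in> carrier R; y \<in> carrier R; z \<in> carrier R\<rbrakk> \<Longrightarrow> (x \<oplus> y) \<otimes> z = x \<otimes> z \<oplus> y \<otimes> z"
    and r_distr: "\<lbrakk>x \<in> carrier R; y \<in> carrier R; z \<in> carrier R\<rbrakk> \<Longrightarrow> z \<otimes> (x \<oplus> y) = z \<otimes> x \<oplus> z \<otimes> y"

lemma (in ring) rng: "rng R"
  by unfold_locales (simp_all add: m_assoc l_distr r_distr)

definition rng_hom :: "('a, 'm) ring_scheme \<Rightarrow> ('b, 'n) ring_scheme \<Rightarrow> ('a \<Rightarrow> 'b) set" where
  "rng_hom R S = {h \<in> carrier R \<rightarrow> carrier S. \<forall>x\<in>carrier R. \<forall>y\<in>carrier R.
     h (x \<otimes>\<^bsub>R\<^esub> y) = h x \<otimes>\<^bsub>S\<^esub> h y \<and> h (x \<oplus>\<^bsub>R\<^esub> y) = h x \<oplus>\<^bsub>S\<^esub> h y}"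

lemma rng_homI:
  assumes "\<And>x. x \<in> carrier R \<Longrightarrow> h x \<in> carrier S"
    and "\<And>x y. \<lbrakk>x \<in> carrier R; y \<in> carrier R\<rbrakk> \<Longrightarrow> h (x \<otimes>\<^bsub>R\<^esub> y) = h x \<otimes>\<^bsub>S\<^esub> h y"
    and "\<And>x y. \<lbrakk>x \<in> carrier R; y \<in> carrier R\<rbrakk> \<Longrightarrow> h (x \<oplus>\<^bsub>R\<^esub> y) = h x \<oplus>\<^bsub>S\<^esub> h y"
  shows "h \<in> rng_hom R S"
  using assms by (simp add: rng_hom_def)

lemma rng_homD:
  assumes "h \<in> rng_hom R S"
  shows "x \<in> carrier R \<Longrightarrow> h x \<in> carrier S"
    and "\<lbrakk>x \<in> carrier R; y \<in> carrier R\<rbrakk> \<Longrightarrow> h (x \<otimes>\<^bsub>R\<^esub> y) = h x \<otimes>\<^bsub>S\<^esub> h y"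
    and "\<lbrakk>x \<in> carrier R; y \<in> carrier R\<rbrakk> \<Longrightarrow> h (x \<oplus>\<^bsub>R\<^esub> y) = h x \<oplus>\<^bsub>S\<^esub> h y"
  using assms by (auto simp: rng_hom_def)

lemma rng_hom_abelian_group_hom:
  assumes "rng R" "rng S" "h \<in> rng_hom R S"
  shows "abelian_group_hom R S h"
proof -
  interpret R: rng R by fact
  interpret S: rng S by fact
  show ?thesis
    using homI[of "add_monoid R" h "add_monoid S"] rng_homD[OF assms(3)]
    by (intro abelian_group_homI R.abelian_group_axioms S.abelian_group_axioms)
      (simp add: group_hom_def group_hom_axioms_def R.a_group S.a_group)
qed

section \<open>Ideals, quotients and induced homomorphisms\<close>

context rng
begin

lemma l_null [simp]: "x \<in> carrier R \<Longrightarrow> \<zero> \<otimes> x = \<zero>"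
  using l_distr[of \<zero> \<zero> x] by (simp add: add.r_cancel_one')

lemma r_null [simp]: "x \<in> carrier R \<Longrightarrow> x \<otimes> \<zero> = \<zero>"
  using r_distr[of \<zero> \<zero> x] by (simp add: add.r_cancel_one')

lemma carrier_rng_ideal: "rng_ideal R (carrier R)"
  by (simp add: rng_ideal_def additive_subgroup_def add.subgroup_self)

lemma rng_ideal_genideal:
  assumes "S \<subseteq> carrier R"
  shows "rng_ideal R (rng_genideal R S)"
proof -
  let ?\<I> = "{I. rng_ideal R I \<and> S \<subseteq> I}"
  \<comment> \<open>An intersection over the empty family would be \<open>UNIV\<close>; the whole
    carrier shows that the family has a member.\<close>
  have ne: "carrier R \<in> ?\<I>"
    using carrier_rng_ideal assms by simp
  have "subgroup (\<Inter>?\<I>) (add_monoid R)"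
    using ne by (intro add.subgroups_Inter) (auto simp: rng_ideal_def additive_subgroup_def)
  then show ?thesis
    by (auto simp: rng_genideal_def rng_ideal_def additive_subgroup_def)
qed

lemma rng_genideal_minimal: "rng_ideal R I \<Longrightarrow> S \<subseteq> I \<Longrightarrow> rng_genideal R S \<subseteq> I"
  by (auto simp: rng_genideal_def)

lemma abelian_subgroup_rng_ideal: "rng_ideal R I \<Longrightarrow> abelian_subgroup I R"
  by (simp add: rng_ideal_def abelian_subgroupI3 abelian_group_axioms)

text \<open>\<open>rcoset_mult\<close> is the union of the cosets of all products of
  representatives. These cosets coincide: for \<open>x' = i \<oplus> x\<close> and
  \<open>y' = j \<oplus> y\<close> the product \<open>x' \<otimes> y'\<close> differs from
  \<open>x \<otimes> y\<close> by \<open>i \<otimes> y' \<oplus> x \<otimes> j\<close>, which lies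
  in \<open>I\<close> by absorption on both sides.\<close>

lemma rcoset_mult_rng_ideal:
  assumes I: "rng_ideal R I" and x: "x \<in> carrier R" and y: "y \<in> carrier R"
  shows "[mod I:] (I +> x) \<Otimes> (I +> y) = I +> (x \<otimes> y)"
proof -
  interpret I: abelian_subgroup I R
    using I by (rule abelian_subgroup_rng_ideal)
  have "I +> (x' \<otimes> y') = I +> (x \<otimes> y)" if "x' \<in> I +> x" "y' \<in> I +> y" for x' y'
  proof -
    from that obtain i j where i: "i \<in> I" "x' = i \<oplus> x" and j: "j \<in> I" "y' = j \<oplus> y"
      by (auto simp: a_r_coset_def')
    have "x' \<otimes> y' = (i \<otimes> y' \<oplus> x \<otimes> j) \<oplus> x \<otimes> y"
      using i j x y by (simp add: l_distr r_distr a_ac)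
    moreover have "i \<otimes> y' \<oplus> x \<otimes> j \<in> I"
      using I i j x y by (auto simp: rng_ideal_def)
    ultimately have "x' \<otimes> y' \<in> I +> (x \<otimes> y)"
      by (auto simp: a_r_coset_def')
    then show ?thesis
      using x y by (metis m_closed I.a_repr_independence')
  qed
  \<comment> \<open>Both cosets have representatives, so the union is not empty.\<close>
  moreover have "x \<in> I +> x" "y \<in> I +> y"
    using x y by (simp_all add: I.a_rcos_self)
  ultimately show ?thesis
    unfolding rcoset_mult_def by (intro equalityI UN_least) blast+
qed

lemma Quot_carrier: "carrier (R Quot I) = (\<lambda>x. I +> x) ` carrier R"
  by (auto simp: FactRing_simps)

lemma Quot_add:
  assumes "rng_ideal R I" "x \<in> carrier R" "y \<in> carrier R"
  shows "(I +> x) \<oplus>\<^bsub>R Quot I\<^esub> (I +> y) = I +> (x \<oplus> y)"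
  using abelian_subgroup.a_rcos_sum[OF abelian_subgroup_rng_ideal] assms by (simp add: FactRing_def)

lemma Quot_mult:
  assumes "rng_ideal R I" "x \<in> carrier R" "y \<in> carrier R"
  shows "(I +> x) \<otimes>\<^bsub>R Quot I\<^esub> (I +> y) = I +> (x \<otimes> y)"
  using rcoset_mult_rng_ideal assms by (simp add: FactRing_def)

lemma rng_Quot:
  assumes I: "rng_ideal R I"
  shows "rng (R Quot I)"
proof -
  interpret I: abelian_subgroup I R
    using I by (rule abelian_subgroup_rng_ideal)
  interpret Q: abelian_group "R Quot I"
    by (rule comm_group_abelian_groupI)
      (simp add: FactRing_def I.a_factorgroup_is_comm_group[unfolded A_FactGroup_def'])
  show ?thesis
    by unfold_locales
      (auto simp: Quot_carrier Quot_add[OF I] Quot_mult[OF I] m_assoc l_distr r_distr)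
qed

lemma rng_ideal_a_kernel:
  assumes "rng S" "h \<in> rng_hom R S"
  shows "rng_ideal R (a_kernel R S h)"
proof -
  interpret S: rng S by fact
  interpret h: abelian_group_hom R S h
    using rng_axioms assms by (rule rng_hom_abelian_group_hom)
  have "x \<otimes> a \<in> a_kernel R S h \<and> a \<otimes> x \<in> a_kernel R S h"
    if x: "x \<in> carrier R" and "a \<in> a_kernel R S h" for x a
  proof -
    from that have a: "a \<in> carrier R" "h a = \<zero>\<^bsub>S\<^esub>"
      unfolding a_kernel_def' by blast+
    have "h (x \<otimes> a) = \<zero>\<^bsub>S\<^esub>" "h (a \<otimes> x) = \<zero>\<^bsub>S\<^esub>"
      unfolding rng_homD(2)[OF assms(2) x a(1)] rng_homD(2)[OF assms(2) a(1) x] a(2)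
      using rng_homD(1)[OF assms(2) x] by (rule S.r_null S.l_null)+
    then show ?thesis
      unfolding a_kernel_def' using x a by simp
  qed
  then show ?thesis
    using h.additive_subgroup_a_kernel by (simp add: rng_ideal_def)
qed

text \<open>As \<open>I\<close> lies in the kernel, \<open>h\<close> is constant on each coset, so
  the image of a coset is a singleton. This is the map induced on the quotient, in the form in which
  \<open>rho_F\<close> and \<open>rho\<close> are defined.\<close>

lemma the_elem_image_rcoset:
  assumes S: "rng S" and h: "h \<in> rng_hom R S" and I: "rng_ideal R I"
    and ker: "I \<subseteq> a_kernel R S h" and x: "x \<in> carrier R"
  shows "the_elem (h ` (I +> x)) = h x"
proof -
  interpret S: rng S by fact
  interpret I: abelian_subgroup I R
    using I by (rule abelian_subgroup_rng_ideal)
  have "h y = h x" if "y \<in> I +> x" for y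
    using that x ker by (auto simp: a_r_coset_def' a_kernel_def' rng_homD[OF h])
  moreover have "x \<in> I +> x"
    using x by (rule I.a_rcos_self)
  ultimately have "h ` (I +> x) = {h x}"
    by blast
  then show ?thesis
    by simp
qed

lemma the_elem_image_rng_hom:
  assumes "rng S" "h \<in> rng_hom R S" "rng_ideal R I" "I \<subseteq> a_kernel R S h"
  shows "(\<lambda>X. the_elem (h ` X)) \<in> rng_hom (R Quot I) S"
  by (rule rng_homI)
    (auto simp: Quot_carrier Quot_add[OF assms(3)] Quot_mult[OF assms(3)] the_elem_image_rcoset[OF assms]
      rng_homD[OF assms(2)])

text \<open>Multiplication by a fixed \<open>y\<close> is an endomorphism of the additive group and
  hence commutes with integer multiples.\<close>

lemma int_scale_mult_left:
  assumes "x \<in> carrier R" "y \<in> carrier R"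
  shows "add_pow R (k :: int) x \<otimes> y = add_pow R k (x \<otimes> y)"
proof -
  have "(\<lambda>x. x \<otimes> y) \<in> hom (add_monoid R) (add_monoid R)"
    using assms by (intro homI) (simp_all add: l_distr)
  from hom_int_pow[OF this _ a_group a_group, of x k] show ?thesis
    using assms by (simp add: add_pow_def[symmetric])
qed

lemma int_scale_mult_right:
  assumes "x \<in> carrier R" "y \<in> carrier R"
  shows "x \<otimes> add_pow R (k :: int) y = add_pow R k (x \<otimes> y)"
proof -
  have "(\<lambda>y. x \<otimes> y) \<in> hom (add_monoid R) (add_monoid R)"
    using assms by (intro homI) (simp_all add: r_distr)
  from hom_int_pow[OF this _ a_group a_group, of y k] show ?thesis
    using assms by (simp add: add_pow_def[symmetric])
qed

end

text \<open>The Dorroh unitization of a ring without unit; \<open>A_ring tri\<close> is the case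
  \<open>R = O_rng tri\<close>. Working with arbitrary \<open>R\<close> keeps cosets of tensors out
  of the ring axioms.\<close>

definition dorroh :: "('a, 'm) ring_scheme \<Rightarrow> (int \<times> 'a) ring" where
  "dorroh R =
    \<lparr>carrier = UNIV \<times> carrier R,
     monoid.mult = (\<lambda>(n, r) (m, s). (n * m, [n] \<cdot>\<^bsub>R\<^esub> s \<oplus>\<^bsub>R\<^esub> [m] \<cdot>\<^bsub>R\<^esub> r \<oplus>\<^bsub>R\<^esub> r \<otimes>\<^bsub>R\<^esub> s)),
     one = (1, \<zero>\<^bsub>R\<^esub>), ring.zero = (0, \<zero>\<^bsub>R\<^esub>),
     ring.add = (\<lambda>(n, r) (m, s). (n + m, r \<oplus>\<^bsub>R\<^esub> s))\<rparr>"

context rng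
begin

lemmas int_scale_simps = add.int_pow_mult add.int_pow_pow add.int_pow_distrib
  int_scale_mult_left int_scale_mult_right

lemma ring_dorroh: "ring (dorroh R)"
proof (rule ringI)
  show "abelian_group (dorroh R)"
  proof (rule abelian_groupI)
    show "\<exists>y\<in>carrier (dorroh R). y \<oplus>\<^bsub>dorroh R\<^esub> x = \<zero>\<^bsub>dorroh R\<^esub>" if "x \<in> carrier (dorroh R)" for x
      using that by (intro bexI[of _ "(- fst x, \<ominus> snd x)"]) (auto simp: dorroh_def l_neg)
  qed (auto simp: dorroh_def a_ac)
  show "Group.monoid (dorroh R)"
    by (rule monoidI)
      (auto simp: dorroh_def int_scale_simps l_distr r_distr m_assoc a_ac mult.assoc mult.commute)
qed (auto simp: dorroh_def int_scale_simps l_distr r_distr a_ac algebra_simps)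

text \<open>Universal property of the unitization: a homomorphism of rings without unit into a
  unital ring extends by sending an integer to that multiple of the unit. The extension of
  \<open>rho\<close> is \<open>rho_hat\<close>.\<close>

lemma dorroh_ring_hom:
  assumes S: "ring S" and h: "h \<in> rng_hom R S"
  shows "(\<lambda>(n :: int, u). [n] \<cdot>\<^bsub>S\<^esub> \<one>\<^bsub>S\<^esub> \<oplus>\<^bsub>S\<^esub> h u) \<in> ring_hom (dorroh R) S"
proof -
  interpret S: ring S by fact
  interpret Srng: rng S by (rule S.rng)
  interpret h: abelian_group_hom R S h
    using rng_axioms S.rng h by (rule rng_hom_abelian_group_hom)
  have scale: "h (add_pow R (k :: int) x) = add_pow S k (h x)" if "x \<in> carrier R" for k x
    using group_hom.hom_int_pow[OF h.a_group_hom, of x k] that by (simp add: add_pow_def[symmetric])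
  show ?thesis
    by (rule ring_hom_memI)
      (auto simp: dorroh_def scale rng_homD[OF h] Srng.int_scale_simps S.l_distr S.r_distr S.a_ac
        mult.commute)
qed

end

section \<open>Square-zero extensions and their factor sets\<close>

lemma cochains_closed: "f \<in> cochains R M n \<Longrightarrow> xs \<in> tuples R n \<Longrightarrow> f xs \<in> carrier M"
  by (auto simp: cochains_def)

lemma cochains_add:
  "\<lbrakk>f \<in> cochains R M n; xs \<in> tuples R n; i < n; x \<in> carrier R; y \<in> carrier R\<rbrakk> \<Longrightarrow>
     f (xs[i := x \<oplus>\<^bsub>R\<^esub> y]) = f (xs[i := x]) \<oplus>\<^bsub>M\<^esub> f (xs[i := y])"
  by (simp add: cochains_def)

lemma tuples_update: "xs \<in> tuples R n \<Longrightarrow> x \<in> carrier R \<Longrightarrow> xs[i := x] \<in> tuples R n"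
  using set_update_subset_insert[of xs i x] by (auto simp: tuples_def)

lemma cochainsI:
  assumes "f \<in> extensional (tuples R n)"
    and "\<And>xs. xs \<in> tuples R n \<Longrightarrow> f xs \<in> carrier M"
    and "\<And>xs i x y. \<lbrakk>xs \<in> tuples R n; i < n; x \<in> carrier R; y \<in> carrier R\<rbrakk> \<Longrightarrow>
      f (xs[i := x \<oplus>\<^bsub>R\<^esub> y]) = f (xs[i := x]) \<oplus>\<^bsub>M\<^esub> f (xs[i := y])"
  shows "f \<in> cochains R M n"
  using assms by (auto simp: cochains_def PiE_def)

lemma tuples_1_iff: "xs \<in> tuples R (Suc 0) \<longleftrightarrow> (\<exists>x\<in>carrier R. xs = [x])"
  by (auto simp: tuples_def length_Suc_conv)

lemma tuples_2_iff: "xs \<in> tuples R 2 \<longleftrightarrow> (\<exists>x\<in>carrier R. \<exists>y\<in>carrier R. xs = [x, y])"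
  by (auto simp: tuples_def length_Suc_conv numeral_2_eq_2)

lemma tuples_3_iff:
  "xs \<in> tuples R 3 \<longleftrightarrow> (\<exists>x\<in>carrier R. \<exists>y\<in>carrier R. \<exists>z\<in>carrier R. xs = [x, y, z])"
  by (auto simp: tuples_def length_Suc_conv numeral_3_eq_3)

lemma cochains_1I:
  assumes "f \<in> extensional (tuples R (Suc 0))"
    and "\<And>x. x \<in> carrier R \<Longrightarrow> f [x] \<in> carrier M"
    and "\<And>x y. \<lbrakk>x \<in> carrier R; y \<in> carrier R\<rbrakk> \<Longrightarrow> f [x \<oplus>\<^bsub>R\<^esub> y] = f [x] \<oplus>\<^bsub>M\<^esub> f [y]"
  shows "f \<in> cochains R M (Suc 0)"
  using assms by (intro cochainsI) (auto simp: tuples_1_iff)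

lemma cochains_2I:
  assumes "f \<in> extensional (tuples R 2)"
    and "\<And>x y. \<lbrakk>x \<in> carrier R; y \<in> carrier R\<rbrakk> \<Longrightarrow> f [x, y] \<in> carrier M"
    and "\<And>x x' y. \<lbrakk>x \<in> carrier R; x' \<in> carrier R; y \<in> carrier R\<rbrakk> \<Longrightarrow>
      f [x \<oplus>\<^bsub>R\<^esub> x', y] = f [x, y] \<oplus>\<^bsub>M\<^esub> f [x', y]"
    and "\<And>x y y'. \<lbrakk>x \<in> carrier R; y \<in> carrier R; y' \<in> carrier R\<rbrakk> \<Longrightarrow>
      f [x, y \<oplus>\<^bsub>R\<^esub> y'] = f [x, y] \<oplus>\<^bsub>M\<^esub> f [x, y']"
  shows "f \<in> cochains R M 2"
  using assms by (intro cochainsI) (auto simp: tuples_2_iff less_2_cases_iff)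

lemma group_cochain_group:
  assumes "abelian_group R" "abelian_group M"
  shows "group (cochain_group R M n)"
proof -
  interpret R: abelian_group R by fact
  interpret M: abelian_group M by fact
  let ?C = "cochain_group R M n"
  have carrier: "carrier ?C = cochains R M n"
    and mult: "f \<otimes>\<^bsub>?C\<^esub> g = (\<lambda>xs\<in>tuples R n. f xs \<oplus>\<^bsub>M\<^esub> g xs)"
    and one: "\<one>\<^bsub>?C\<^esub> = (\<lambda>xs\<in>tuples R n. \<zero>\<^bsub>M\<^esub>)" for f g
    by (simp_all add: cochain_group_def)
  show ?thesis
  proof (rule groupI, unfold carrier mult one)
    fix f g
    assume f: "f \<in> cochains R M n" and g: "g \<in> cochains R M n"
    show "(\<lambda>xs\<in>tuples R n. f xs \<oplus>\<^bsub>M\<^esub> g xs) \<in> cochains R M n"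
      using cochains_closed[OF f] cochains_closed[OF g]
      by (intro cochainsI) (simp_all add: tuples_update cochains_add[OF f] cochains_add[OF g] M.a_ac)
  next
    show "(\<lambda>xs\<in>tuples R n. \<zero>\<^bsub>M\<^esub>) \<in> cochains R M n"
      by (intro cochainsI) (simp_all add: tuples_update)
  next
    fix f g h
    assume f: "f \<in> cochains R M n" and g: "g \<in> cochains R M n" and h: "h \<in> cochains R M n"
    show "(\<lambda>xs\<in>tuples R n. (\<lambda>xs\<in>tuples R n. f xs \<oplus>\<^bsub>M\<^esub> g xs) xs \<oplus>\<^bsub>M\<^esub> h xs) =
      (\<lambda>xs\<in>tuples R n. f xs \<oplus>\<^bsub>M\<^esub> (\<lambda>xs\<in>tuples R n. g xs \<oplus>\<^bsub>M\<^esub> h xs) xs)"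
      using cochains_closed[OF f] cochains_closed[OF g] cochains_closed[OF h]
      by (intro restrict_ext) (simp add: M.a_assoc)
  next
    fix f
    assume f: "f \<in> cochains R M n"
    \<comment> \<open>Equality of functions also concerns arguments outside
      \<open>tuples R n\<close>; there restrictions and cochains alike are
      \<open>undefined\<close>.\<close>
    have "f \<in> extensional (tuples R n)"
      using f by (simp add: cochains_def PiE_def)
    then show "(\<lambda>xs\<in>tuples R n. (\<lambda>xs\<in>tuples R n. \<zero>\<^bsub>M\<^esub>) xs \<oplus>\<^bsub>M\<^esub> f xs) = f"
      using cochains_closed[OF f] by (intro extensionalityI[of _ "tuples R n"]) simp_all
    let ?g = "\<lambda>xs\<in>tuples R n. \<ominus>\<^bsub>M\<^esub> f xs"
    have "?g \<in> cochains R M n"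
      using cochains_closed[OF f]
      by (intro cochainsI) (simp_all add: tuples_update cochains_add[OF f] M.minus_add)
    moreover have "(\<lambda>xs\<in>tuples R n. ?g xs \<oplus>\<^bsub>M\<^esub> f xs) = (\<lambda>xs\<in>tuples R n. \<zero>\<^bsub>M\<^esub>)"
      using cochains_closed[OF f] by (intro restrict_ext) (simp add: M.l_neg)
    ultimately show "\<exists>g\<in>cochains R M n.
        (\<lambda>xs\<in>tuples R n. g xs \<oplus>\<^bsub>M\<^esub> f xs) = (\<lambda>xs\<in>tuples R n. \<zero>\<^bsub>M\<^esub>)"
      by (intro bexI[of _ ?g])
  qed
qed

text \<open>This definition and the next three restate \<open>defect_bimodule\<close>, the two kinds
  of section and \<open>omega\<close> for an arbitrary map \<open>p\<close>, so that the cohomology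
  can be done away from the tensor construction.\<close>

definition lift_bimodule ::
  "('a, 'm) ring_scheme \<Rightarrow> ('b, 'n) ring_scheme \<Rightarrow> ('a \<Rightarrow> 'b) \<Rightarrow> ('b, 'a) bimodule" where
  "lift_bimodule A R p =
    \<lparr>carrier = a_kernel A R p, monoid.mult = monoid.mult A, one = \<zero>\<^bsub>A\<^esub>,
     ring.zero = \<zero>\<^bsub>A\<^esub>, ring.add = ring.add A,
     lact = (\<lambda>r k. the_elem ((\<lambda>a. a \<otimes>\<^bsub>A\<^esub> k) ` {a \<in> carrier A. p a = r})),
     ract = (\<lambda>k r. the_elem ((\<lambda>a. k \<otimes>\<^bsub>A\<^esub> a) ` {a \<in> carrier A. p a = r}))\<rparr>"

definition additive_section ::
  "('a, 'm) ring_scheme \<Rightarrow> ('b, 'n) ring_scheme \<Rightarrow> ('a \<Rightarrow> 'b) \<Rightarrow> ('b \<Rightarrow> 'a) \<Rightarrow> bool" where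
  "additive_section A R p s \<longleftrightarrow>
     s \<in> hom (add_monoid R) (add_monoid A) \<and> (\<forall>r\<in>carrier R. p (s r) = r) \<and> s \<one>\<^bsub>R\<^esub> = \<one>\<^bsub>A\<^esub>"

definition ring_section ::
  "('a, 'm) ring_scheme \<Rightarrow> ('b, 'n) ring_scheme \<Rightarrow> ('a \<Rightarrow> 'b) \<Rightarrow> ('b \<Rightarrow> 'a) \<Rightarrow> bool" where
  "ring_section A R p s \<longleftrightarrow> s \<in> ring_hom R A \<and> (\<forall>r\<in>carrier R. p (s r) = r)"

definition factor_set ::
  "('a, 'm) ring_scheme \<Rightarrow> ('b, 'n) ring_scheme \<Rightarrow> ('b \<Rightarrow> 'a) \<Rightarrow> 'b list \<Rightarrow> 'a" where
  "factor_set A R s = (\<lambda>xs\<in>tuples R 2.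
     s (xs ! 0) \<otimes>\<^bsub>A\<^esub> s (xs ! 1) \<ominus>\<^bsub>A\<^esub> s (xs ! 0 \<otimes>\<^bsub>R\<^esub> xs ! 1))"

lemma additive_sectionD:
  assumes "additive_section A R p s"
  shows "r \<in> carrier R \<Longrightarrow> s r \<in> carrier A"
    and "r \<in> carrier R \<Longrightarrow> p (s r) = r"
    and "\<lbrakk>r \<in> carrier R; r' \<in> carrier R\<rbrakk> \<Longrightarrow> s (r \<oplus>\<^bsub>R\<^esub> r') = s r \<oplus>\<^bsub>A\<^esub> s r'"
    and "s \<one>\<^bsub>R\<^esub> = \<one>\<^bsub>A\<^esub>"
  using assms by (auto simp: additive_section_def hom_def)

lemma ring_section_additive_section: "ring_section A R p s \<Longrightarrow> additive_section A R p s"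
  by (auto simp: ring_section_def additive_section_def ring_hom_def hom_def)

text \<open>Collects what the cohomological argument uses about \<open>A_ring\<close>,
  \<open>R_ring\<close> and \<open>rho_hat\<close>. The square-zero condition is elementwise, the
  form in which it kills quadratic terms.\<close>

locale square_zero_extension = A?: ring A + R: ring R for A (structure) and R +
  fixes p
  assumes p_hom: "p \<in> ring_hom A R"
    and surj: "p ` carrier A = carrier R"
    and square_zero: "\<lbrakk>k \<in> a_kernel A R p; l \<in> a_kernel A R p\<rbrakk> \<Longrightarrow> k \<otimes> l = \<zero>"
begin

abbreviation K where "K \<equiv> a_kernel A R p"
abbreviation M where "M \<equiv> lift_bimodule A R p"

sublocale p: ring_hom_ring A R p
  by (intro ring_hom_ringI2 p_hom A.ring_axioms R.ring_axioms)

section \<open>The kernel as a bimodule, and the differential in degrees 1 and 2\<close>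

lemma K_iff: "k \<in> K \<longleftrightarrow> k \<in> carrier A \<and> p k = \<zero>\<^bsub>R\<^esub>"
  unfolding a_kernel_def' by blast

lemma K_carrier: "k \<in> K \<Longrightarrow> k \<in> carrier A"
  by (simp add: K_iff)

lemma K_closed [simp, intro]:
  "k \<in> K \<Longrightarrow> l \<in> K \<Longrightarrow> k \<oplus> l \<in> K"
  "k \<in> K \<Longrightarrow> \<ominus> k \<in> K"
  "k \<in> K \<Longrightarrow> l \<in> K \<Longrightarrow> k \<ominus> l \<in> K"
  "\<zero> \<in> K"
  "a \<in> carrier A \<Longrightarrow> k \<in> K \<Longrightarrow> a \<otimes> k \<in> K"
  "a \<in> carrier A \<Longrightarrow> k \<in> K \<Longrightarrow> k \<otimes> a \<in> K"
  by (auto simp: K_iff a_minus_def)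

lemma diff_in_K: "\<lbrakk>a \<in> carrier A; b \<in> carrier A; p a = p b\<rbrakk> \<Longrightarrow> a \<ominus> b \<in> K"
  by (simp add: K_iff a_minus_def R.r_neg)

lemma M_simps [simp]:
  "carrier M = K" "ring.zero M = \<zero>" "ring.add M = ring.add A"
  by (simp_all add: lift_bimodule_def)

lemma abelian_group_M: "abelian_group M"
proof (rule abelian_groupI)
  show "\<exists>y\<in>carrier M. y \<oplus>\<^bsub>M\<^esub> x = \<zero>\<^bsub>M\<^esub>" if "x \<in> carrier M" for x
    using that K_carrier[of x] by (intro bexI[of _ "\<ominus> x"]) (auto simp: l_neg)
qed (auto simp: K_carrier a_ac)

sublocale M: abelian_group M
  by (rule abelian_group_M)

text \<open>Signs in \<open>hochschild_d\<close> are integer multiples formed in \<open>M\<close>;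
  this moves the minus sign to \<open>A\<close>, where the computations take place.\<close>

lemma M_inv: "k \<in> K \<Longrightarrow> \<ominus>\<^bsub>M\<^esub> k = \<ominus> k"
  using K_carrier[of k] by (intro M.minus_equality) (auto simp: l_neg)

text \<open>Two lifts of the same element differ by a member of \<open>K\<close>, which annihilates
  \<open>k\<close> because \<open>K\<close> has square zero. So the set of products is a singleton
  and \<open>the_elem\<close> may be evaluated at any chosen lift.\<close>

lemma lact_lift:
  assumes a: "a \<in> carrier A" and k: "k \<in> K"
  shows "lact M (p a) k = a \<otimes> k"
proof -
  have "b \<otimes> k = a \<otimes> k" if b: "b \<in> carrier A" and "p b = p a" for b
  proof -
    have "(a \<oplus> (b \<ominus> a)) \<otimes> k = a \<otimes> k \<oplus> (b \<ominus> a) \<otimes> k"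
      using a b K_carrier[OF k] by (simp only: l_distr minus_closed)
    also have "(b \<ominus> a) \<otimes> k = \<zero>"
      using diff_in_K[OF b a] that k by (intro square_zero)
    also have "a \<oplus> (b \<ominus> a) = b"
      using a b by (simp add: a_minus_def a_lcomm[of a b] r_neg)
    finally show ?thesis
      using a K_carrier[OF k] by simp
  qed
  then have "(\<lambda>b. b \<otimes> k) ` {b \<in> carrier A. p b = p a} = {a \<otimes> k}"
    using a by blast
  then show ?thesis
    by (simp add: lift_bimodule_def)
qed

lemma ract_lift:
  assumes a: "a \<in> carrier A" and k: "k \<in> K"
  shows "ract M k (p a) = k \<otimes> a"
proof -
  have "k \<otimes> b = k \<otimes> a" if b: "b \<in> carrier A" and "p b = p a" for b
  proof -
    have "k \<otimes> (a \<oplus> (b \<ominus> a)) = k \<otimes> a \<oplus> k \<otimes> (b \<ominus> a)"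
      using a b K_carrier[OF k] by (simp only: r_distr minus_closed)
    also have "k \<otimes> (b \<ominus> a) = \<zero>"
      using diff_in_K[OF b a] that k by (intro square_zero)
    also have "a \<oplus> (b \<ominus> a) = b"
      using a b by (simp add: a_minus_def a_lcomm[of a b] r_neg)
    finally show ?thesis
      using a K_carrier[OF k] by simp
  qed
  then have "(\<lambda>b. k \<otimes> b) ` {b \<in> carrier A. p b = p a} = {k \<otimes> a}"
    using a by blast
  then show ?thesis
    by (simp add: lift_bimodule_def)
qed

text \<open>Naming the arguments through lifts \<open>a\<close> and \<open>b\<close> turns both
  actions into products of \<open>A\<close>, so that later identities are plain ring identities. The
  lifts are free to choose, for instance as values of a section.\<close>

lemma hochschild_d_1:
  assumes f: "f \<in> cochains R M (Suc 0)" and "a \<in> carrier A" "b \<in> carrier A"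
  shows "hochschild_d R M (Suc 0) f [p a, p b] = a \<otimes> f [p b] \<ominus> f [p (a \<otimes> b)] \<oplus> f [p a] \<otimes> b"
proof -
  have fK: "f [p c] \<in> K" if "c \<in> carrier A" for c
    using cochains_closed[OF f, of "[p c]"] that by (simp add: tuples_1_iff)
  have "[p a, p b] \<in> tuples R (Suc (Suc 0))"
    using assms by (simp add: tuples_def)
  moreover have "f [p a \<otimes>\<^bsub>R\<^esub> p b] \<in> K"
    using fK[of "a \<otimes> b"] assms by simp
  ultimately show ?thesis
    using assms fK by (simp add: hochschild_d_def lact_lift ract_lift lessThan_Suc
      M.add.int_pow_neg M_inv a_minus_def K_carrier)
qed

lemma hochschild_d_2:
  assumes f: "f \<in> cochains R M 2" and "a \<in> carrier A" "b \<in> carrier A" "c \<in> carrier A"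
  shows "hochschild_d R M 2 f [p a, p b, p c] =
    a \<otimes> f [p b, p c] \<ominus> f [p (a \<otimes> b), p c] \<oplus> f [p a, p (b \<otimes> c)] \<ominus> f [p a, p b] \<otimes> c"
proof -
  have fK: "f [p u, p v] \<in> K" if "u \<in> carrier A" "v \<in> carrier A" for u v
    using cochains_closed[OF f, of "[p u, p v]"] that by (simp add: tuples_2_iff)
  have "[p a, p b, p c] \<in> tuples R (Suc 2)"
    using assms by (simp add: tuples_def)
  moreover have "f [p a \<otimes>\<^bsub>R\<^esub> p b, p c] \<in> K" "f [p a, p b \<otimes>\<^bsub>R\<^esub> p c] \<in> K"
    using fK[of "a \<otimes> b" c] fK[of a "b \<otimes> c"] assms by simp_all
  \<comment> \<open>The two indices of the inner sum, carrying the signs minus and plus.\<close>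
  moreover have "{..<2} = {0, Suc 0}"
    by auto
  ultimately show ?thesis
    using assms fK[of b c] fK[of a b]
    by (simp add: hochschild_d_def lact_lift ract_lift
      M.add.int_pow_neg M_inv a_minus_def a_ac K_carrier)
qed

section \<open>Factor sets of additive sections\<close>

lemma lift_exists:
  assumes "r \<in> carrier R"
  obtains a where "a \<in> carrier A" "p a = r"
  using assms surj by (metis imageE)

lemma section_product_diff_in_K:
  assumes s: "additive_section A R p s" and "x \<in> carrier R" "y \<in> carrier R"
  shows "s x \<otimes> s y \<ominus> s (x \<otimes>\<^bsub>R\<^esub> y) \<in> K"
  using assms(2,3) by (intro diff_in_K) (simp_all add: additive_sectionD[OF s])

lemma factor_set_eq:
  assumes "x \<in> carrier R" "y \<in> carrier R"
  shows "factor_set A R s [x, y] = s x \<otimes> s y \<ominus> s (x \<otimes>\<^bsub>R\<^esub> y)"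
  using assms by (simp add: factor_set_def tuples_2_iff)

lemma factor_set_cochain:
  assumes s: "additive_section A R p s"
  shows "factor_set A R s \<in> cochains R M 2"
proof (rule cochains_2I)
  note sD = additive_sectionD[OF s]
  show "factor_set A R s \<in> extensional (tuples R 2)"
    by (simp add: factor_set_def)
  fix x y
  assume x: "x \<in> carrier R" and y: "y \<in> carrier R"
  then show "factor_set A R s [x, y] \<in> carrier M"
    using section_product_diff_in_K[OF s] by (simp add: factor_set_eq)
  fix x'
  assume x': "x' \<in> carrier R"
  have car: "s x \<in> carrier A" "s y \<in> carrier A" "s x' \<in> carrier A"
      "s (x \<otimes>\<^bsub>R\<^esub> y) \<in> carrier A" "s (x' \<otimes>\<^bsub>R\<^esub> y) \<in> carrier A" "s (x \<otimes>\<^bsub>R\<^esub> x') \<in> carrier A"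
    using x y x' by (simp_all add: sD)
  have "(s x \<oplus> s x') \<otimes> s y \<ominus> (s (x \<otimes>\<^bsub>R\<^esub> y) \<oplus> s (x' \<otimes>\<^bsub>R\<^esub> y)) =
      (s x \<otimes> s y \<ominus> s (x \<otimes>\<^bsub>R\<^esub> y)) \<oplus> (s x' \<otimes> s y \<ominus> s (x' \<otimes>\<^bsub>R\<^esub> y))"
    using car by algebra
  then show "factor_set A R s [x \<oplus>\<^bsub>R\<^esub> x', y] = factor_set A R s [x, y] \<oplus>\<^bsub>M\<^esub> factor_set A R s [x', y]"
    using x y x' by (simp add: factor_set_eq sD R.l_distr)
  have "s x \<otimes> (s y \<oplus> s x') \<ominus> (s (x \<otimes>\<^bsub>R\<^esub> y) \<oplus> s (x \<otimes>\<^bsub>R\<^esub> x')) =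
      (s x \<otimes> s y \<ominus> s (x \<otimes>\<^bsub>R\<^esub> y)) \<oplus> (s x \<otimes> s x' \<ominus> s (x \<otimes>\<^bsub>R\<^esub> x'))"
    using car by algebra
  then show "factor_set A R s [x, y \<oplus>\<^bsub>R\<^esub> x'] = factor_set A R s [x, y] \<oplus>\<^bsub>M\<^esub> factor_set A R s [x, x']"
    using x y x' by (simp add: factor_set_eq sD R.r_distr)
qed

text \<open>Since \<open>s\<close> is unital, an argument equal to one makes both terms of the
  factor set equal to the value of \<open>s\<close> at the other argument.\<close>

lemma factor_set_normalized:
  assumes s: "additive_section A R p s"
  shows "normalized R M 2 (factor_set A R s)"
proof -
  note sD = additive_sectionD[OF s]
  show ?thesis
    by (auto simp: normalized_def tuples_2_iff factor_set_eq sD a_minus_def r_neg)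
qed

text \<open>The cocycle identity is associativity: the triple products of values of \<open>s\<close>
  cancel in \<open>A\<close>, the values of \<open>s\<close> at the triple product cancel by
  associativity in \<open>R\<close>, and the mixed terms cancel in pairs.\<close>

lemma factor_set_cocycle:
  assumes s: "additive_section A R p s"
  shows "factor_set A R s \<in> cocycles R M 2"
proof -
  note sD = additive_sectionD[OF s]
  let ?\<omega> = "factor_set A R s"
  have "hochschild_d R M 2 ?\<omega> xs = \<zero>" if xs: "xs \<in> tuples R 3" for xs
  proof -
    obtain x y z where x: "x \<in> carrier R" and y: "y \<in> carrier R" and z: "z \<in> carrier R"
      and xs: "xs = [x, y, z]"
      using xs by (auto simp: tuples_3_iff)
    let ?a = "s x" and ?b = "s y" and ?c = "s z" and ?d = "s (x \<otimes>\<^bsub>R\<^esub> y)" and ?e = "s (y \<otimes>\<^bsub>R\<^esub> z)"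
      and ?f = "s (x \<otimes>\<^bsub>R\<^esub> y \<otimes>\<^bsub>R\<^esub> z)"
    have car: "?a \<in> carrier A" "?b \<in> carrier A" "?c \<in> carrier A" "?d \<in> carrier A"
        "?e \<in> carrier A" "?f \<in> carrier A"
      using x y z by (simp_all add: sD)
    \<comment> \<open>The section itself supplies the lifts of \<open>x\<close>, \<open>y\<close>
      and \<open>z\<close>.\<close>
    have "hochschild_d R M 2 ?\<omega> xs = ?a \<otimes> ?\<omega> [y, z] \<ominus> ?\<omega> [x \<otimes>\<^bsub>R\<^esub> y, z] \<oplus> ?\<omega> [x, y \<otimes>\<^bsub>R\<^esub> z] \<ominus> ?\<omega> [x, y] \<otimes> ?c"
      using hochschild_d_2[OF factor_set_cochain[OF s] car(1-3)] x y z car by (simp add: xs sD)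
    also have "\<dots> = ?a \<otimes> (?b \<otimes> ?c \<ominus> ?e) \<ominus> (?d \<otimes> ?c \<ominus> ?f) \<oplus> (?a \<otimes> ?e \<ominus> ?f) \<ominus> (?a \<otimes> ?b \<ominus> ?d) \<otimes> ?c"
      using x y z by (simp add: factor_set_eq R.m_assoc)
    also have "\<dots> = \<zero>"
      using car by algebra
    finally show ?thesis .
  qed
  moreover have "Suc 2 = 3"
    by simp
  ultimately have "hochschild_d R M 2 ?\<omega> = \<one>\<^bsub>cochain_group R M (Suc 2)\<^esub>"
    unfolding cochain_group_def
    by (intro extensionalityI[of _ "tuples R 3"]) (simp_all add: hochschild_d_def)
  then show ?thesis
    using factor_set_cochain[OF s] by (simp add: cocycles_def kernel_def cochain_group_def)
qed

section \<open>Degree 2 coboundaries and change of section\<close>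

lemma cochain_1_in_K: "f \<in> cochains R M (Suc 0) \<Longrightarrow> r \<in> carrier R \<Longrightarrow> f [r] \<in> K"
  using cochains_closed[of f R M "Suc 0" "[r]"] by (simp add: tuples_1_iff)

lemma cochain_1_add:
  "\<lbrakk>f \<in> cochains R M (Suc 0); r \<in> carrier R; r' \<in> carrier R\<rbrakk> \<Longrightarrow> f [r \<oplus>\<^bsub>R\<^esub> r'] = f [r] \<oplus> f [r']"
  using cochains_add[of f R M "Suc 0" "[r]" 0 r r'] by (simp add: tuples_1_iff)

lemma group_cochains: "group (cochain_group R M n)"
  by (rule group_cochain_group[OF R.abelian_group_axioms abelian_group_M])

lemma cochain_group_simps:
  "carrier (cochain_group R M n) = cochains R M n"
  "f \<otimes>\<^bsub>cochain_group R M n\<^esub> g = (\<lambda>xs\<in>tuples R n. f xs \<oplus> g xs)"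
  "\<one>\<^bsub>cochain_group R M n\<^esub> = (\<lambda>xs\<in>tuples R n. \<zero>)"
  by (simp_all add: cochain_group_def)

lemma hochschild_d_1_extensional: "hochschild_d R M (Suc 0) f \<in> extensional (tuples R 2)"
  by (simp add: hochschild_d_def numeral_2_eq_2)

text \<open>Biadditivity is checked on lifts; once additivity of \<open>f\<close> has been applied,
  its values enter only as elements of \<open>A\<close>, and each case is a ring identity.\<close>

lemma hochschild_d_1_cochain:
  assumes f: "f \<in> cochains R M (Suc 0)"
  shows "hochschild_d R M (Suc 0) f \<in> cochains R M 2"
proof (rule cochains_2I)
  let ?d = "hochschild_d R M (Suc 0) f"
  show "?d \<in> extensional (tuples R 2)"
    by (rule hochschild_d_1_extensional)
  fix x y
  assume x: "x \<in> carrier R" and y: "y \<in> carrier R"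
  obtain a where a: "a \<in> carrier A" "p a = x"
    using x by (rule lift_exists)
  obtain b where b: "b \<in> carrier A" "p b = y"
    using y by (rule lift_exists)
  have fK: "f [p u] \<in> K" if "u \<in> carrier A" for u
    using cochain_1_in_K[OF f] that by simp
  show "?d [x, y] \<in> carrier M"
    using hochschild_d_1[OF f a(1) b(1)] fK[of a] fK[of b] fK[of "a \<otimes> b"] a b by simp
  fix x'
  assume x': "x' \<in> carrier R"
  obtain c where c: "c \<in> carrier A" "p c = x'"
    using x' by (rule lift_exists)
  note car = a(1) b(1) c(1) fK[THEN K_carrier]
  have sum: "f [p (u \<oplus> v)] = f [p u] \<oplus> f [p v]" if "u \<in> carrier A" "v \<in> carrier A" for u v
    using that cochain_1_add[OF f] by simp
  have "(a \<oplus> c) \<otimes> f [p b] \<ominus> (f [p (a \<otimes> b)] \<oplus> f [p (c \<otimes> b)]) \<oplus> (f [p a] \<oplus> f [p c]) \<otimes> b =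
      (a \<otimes> f [p b] \<ominus> f [p (a \<otimes> b)] \<oplus> f [p a] \<otimes> b) \<oplus> (c \<otimes> f [p b] \<ominus> f [p (c \<otimes> b)] \<oplus> f [p c] \<otimes> b)"
    using car(1-3) car(4)[OF a(1)] car(4)[OF b(1)] car(4)[OF c(1)]
      car(4)[OF m_closed[OF a(1) b(1)]] car(4)[OF m_closed[OF c(1) b(1)]] by algebra
  then have "?d [p (a \<oplus> c), p b] = ?d [p a, p b] \<oplus> ?d [p c, p b]"
    using a(1) b(1) c(1) by (simp only: hochschild_d_1[OF f] sum l_distr a_closed m_closed)
  then show "?d [x \<oplus>\<^bsub>R\<^esub> x', y] = ?d [x, y] \<oplus>\<^bsub>M\<^esub> ?d [x', y]"
    using a b c by simp
  have "a \<otimes> (f [p b] \<oplus> f [p c]) \<ominus> (f [p (a \<otimes> b)] \<oplus> f [p (a \<otimes> c)]) \<oplus> f [p a] \<otimes> (b \<oplus> c) =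
      (a \<otimes> f [p b] \<ominus> f [p (a \<otimes> b)] \<oplus> f [p a] \<otimes> b) \<oplus> (a \<otimes> f [p c] \<ominus> f [p (a \<otimes> c)] \<oplus> f [p a] \<otimes> c)"
    using car(1-3) car(4)[OF a(1)] car(4)[OF b(1)] car(4)[OF c(1)]
      car(4)[OF m_closed[OF a(1) b(1)]] car(4)[OF m_closed[OF a(1) c(1)]] by algebra
  then have "?d [p a, p (b \<oplus> c)] = ?d [p a, p b] \<oplus> ?d [p a, p c]"
    using a(1) b(1) c(1) by (simp only: hochschild_d_1[OF f] sum r_distr a_closed m_closed)
  then show "?d [x, y \<oplus>\<^bsub>R\<^esub> x'] = ?d [x, y] \<oplus>\<^bsub>M\<^esub> ?d [x, x']"
    using a b c by simp
qed

text \<open>Presents the coboundaries as the image of a group homomorphism, hence as a subgroup,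
  which the coset arguments require.\<close>

lemma hochschild_d_1_hom:
  "group_hom (cochain_group R M (Suc 0)) (cochain_group R M 2) (hochschild_d R M (Suc 0))"
proof (intro group_hom.intro group_hom_axioms.intro group_cochains homI, unfold cochain_group_simps)
  fix f g
  assume f: "f \<in> cochains R M (Suc 0)" and g: "g \<in> cochains R M (Suc 0)"
  let ?h = "\<lambda>xs\<in>tuples R (Suc 0). f xs \<oplus> g xs"
  have h: "?h \<in> cochains R M (Suc 0)"
    using group.is_monoid[OF group_cochains[of "Suc 0"], THEN monoid.m_closed, of f g] f g
    by (simp add: cochain_group_simps)
  have "hochschild_d R M (Suc 0) ?h [x, y] =
      hochschild_d R M (Suc 0) f [x, y] \<oplus> hochschild_d R M (Suc 0) g [x, y]"
    if x: "x \<in> carrier R" and y: "y \<in> carrier R" for x y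
  proof -
    obtain a where a: "a \<in> carrier A" "p a = x"
      using x by (rule lift_exists)
    obtain b where b: "b \<in> carrier A" "p b = y"
      using y by (rule lift_exists)
    let ?xy = "x \<otimes>\<^bsub>R\<^esub> y"
    have d: "hochschild_d R M (Suc 0) k [x, y] = a \<otimes> k [y] \<ominus> k [?xy] \<oplus> k [x] \<otimes> b"
      if "k \<in> cochains R M (Suc 0)" for k
      using hochschild_d_1[OF that a(1) b(1)] a b by simp
    have h_eq: "?h [r] = f [r] \<oplus> g [r]" if "r \<in> carrier R" for r
      using that by (simp add: tuples_1_iff)
    have car: "f [x] \<in> carrier A" "f [y] \<in> carrier A" "f [?xy] \<in> carrier A"
        "g [x] \<in> carrier A" "g [y] \<in> carrier A" "g [?xy] \<in> carrier A"
      using x y cochain_1_in_K[OF f] cochain_1_in_K[OF g] by (simp_all add: K_carrier)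
    have "a \<otimes> (f [y] \<oplus> g [y]) \<ominus> (f [?xy] \<oplus> g [?xy]) \<oplus> (f [x] \<oplus> g [x]) \<otimes> b =
        (a \<otimes> f [y] \<ominus> f [?xy] \<oplus> f [x] \<otimes> b) \<oplus> (a \<otimes> g [y] \<ominus> g [?xy] \<oplus> g [x] \<otimes> b)"
      using car a(1) b(1) by algebra
    then show ?thesis
      unfolding d[OF h] d[OF f] d[OF g] h_eq[OF x] h_eq[OF y] h_eq[OF R.m_closed[OF x y]] .
  qed
  then show "hochschild_d R M (Suc 0) ?h =
      (\<lambda>xs\<in>tuples R 2. hochschild_d R M (Suc 0) f xs \<oplus> hochschild_d R M (Suc 0) g xs)"
    by (intro extensionalityI[of _ "tuples R 2"] hochschild_d_1_extensional)
      (auto simp: tuples_2_iff)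
qed (rule hochschild_d_1_cochain)

lemma coboundaries_2: "coboundaries R M 2 = hochschild_d R M (Suc 0) ` cochains R M (Suc 0)"
  by (simp add: numeral_2_eq_2)

lemma coboundaries_subgroup: "subgroup (coboundaries R M 2) (cochain_group R M 2)"
  using group_hom.img_is_subgroup[OF hochschild_d_1_hom] by (simp add: coboundaries_2 cochain_group_simps)

text \<open>A right coset depends only on the multiplication, which cocycles inherit from cochains.
  Classes can thus be compared inside the full cochain group.\<close>

lemma HH_class_eq: "HH_class R M 2 f = coboundaries R M 2 #>\<^bsub>cochain_group R M 2\<^esub> f"
  by (simp add: HH_class_def r_coset_def cocycle_group_def)

lemma HH_one: "\<one>\<^bsub>HH R M n\<^esub> = coboundaries R M n"
  by (simp add: HH_def)

lemma HH_class_one_iff: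
  assumes "f \<in> cochains R M 2"
  shows "HH_class R M 2 f = \<one>\<^bsub>HH R M 2\<^esub> \<longleftrightarrow> f \<in> coboundaries R M 2"
  using group.coset_join1[OF group_cochains _ _ coboundaries_subgroup, of f]
    group.coset_join2[OF group_cochains _ coboundaries_subgroup, of f] assms
  by (auto simp: HH_class_eq HH_one cochain_group_simps)

lemma factor_set_twist:
  assumes s: "additive_section A R p s" and s': "additive_section A R p s'"
    and f: "f \<in> cochains R M (Suc 0)"
    and eq: "\<And>r. r \<in> carrier R \<Longrightarrow> s' r = s r \<oplus> f [r]"
  shows "factor_set A R s' = hochschild_d R M (Suc 0) f \<otimes>\<^bsub>cochain_group R M 2\<^esub> factor_set A R s"
proof -
  note sD = additive_sectionD[OF s]
  have "factor_set A R s' [x, y] = hochschild_d R M (Suc 0) f [x, y] \<oplus> factor_set A R s [x, y]"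
    if x: "x \<in> carrier R" and y: "y \<in> carrier R" for x y
  proof -
    let ?xy = "x \<otimes>\<^bsub>R\<^esub> y"
    have xy: "?xy \<in> carrier R"
      using x y by simp
    have car: "s x \<in> carrier A" "s y \<in> carrier A" "s ?xy \<in> carrier A"
        "f [x] \<in> carrier A" "f [y] \<in> carrier A" "f [?xy] \<in> carrier A"
      using x y xy by (simp_all add: sD K_carrier cochain_1_in_K[OF f])
    have "factor_set A R s' [x, y] = (s x \<oplus> f [x]) \<otimes> (s y \<oplus> f [y]) \<ominus> (s ?xy \<oplus> f [?xy])"
      using x y xy by (simp add: factor_set_eq eq)
    \<comment> \<open>Sorted by degree in \<open>f\<close>: the linear terms are the differential of
      \<open>f\<close>, computed with the lifts \<open>s x\<close> and \<open>s y\<close>; the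
      constant terms are the old factor set; the quadratic term is a product of two elements of
      \<open>K\<close>.\<close>
    also have "\<dots> = (s x \<otimes> f [y] \<ominus> f [?xy] \<oplus> f [x] \<otimes> s y) \<oplus> (s x \<otimes> s y \<ominus> s ?xy) \<oplus> f [x] \<otimes> f [y]"
      using car by algebra
    also have "f [x] \<otimes> f [y] = \<zero>"
      using x y by (intro square_zero cochain_1_in_K[OF f])
    also have "s x \<otimes> f [y] \<ominus> f [?xy] \<oplus> f [x] \<otimes> s y = hochschild_d R M (Suc 0) f [x, y]"
      using hochschild_d_1[OF f car(1,2)] x y car by (simp add: sD)
    finally show ?thesis
      using x y car hochschild_d_1[OF f car(1,2)] by (simp add: factor_set_eq sD)
  qed
  then show ?thesis
    unfolding cochain_group_simps
    by (intro extensionalityI[of _ "tuples R 2"]) (auto simp: tuples_2_iff factor_set_def)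
qed

lemma HH_class_factor_set_unique:
  assumes s: "additive_section A R p s" and s': "additive_section A R p s'"
  shows "HH_class R M 2 (factor_set A R s) = HH_class R M 2 (factor_set A R s')"
proof -
  note sD = additive_sectionD[OF s] and s'D = additive_sectionD[OF s']
  \<comment> \<open>The difference of the two sections, with values in \<open>K\<close> since both
    lift the same element. A 1-cochain is fed singleton lists, whence \<open>hd\<close>.\<close>
  let ?f = "\<lambda>xs\<in>tuples R (Suc 0). s' (hd xs) \<ominus> s (hd xs)"
  have f_eq: "?f [r] = s' r \<ominus> s r" if "r \<in> carrier R" for r
    using that by (simp add: tuples_1_iff)
  have f: "?f \<in> cochains R M (Suc 0)"
  proof (rule cochains_1I)
    fix x y
    assume x: "x \<in> carrier R" and y: "y \<in> carrier R"
    have "(s' x \<oplus> s' y) \<ominus> (s x \<oplus> s y) = (s' x \<ominus> s x) \<oplus> (s' y \<ominus> s y)"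
      using sD(1)[OF x] sD(1)[OF y] s'D(1)[OF x] s'D(1)[OF y] by algebra
    then show "?f [x \<oplus>\<^bsub>R\<^esub> y] = ?f [x] \<oplus>\<^bsub>M\<^esub> ?f [y]"
      using x y by (simp add: f_eq sD s'D del: restrict_apply)
    show "?f [x] \<in> carrier M"
      using diff_in_K[of "s' x" "s x"] x by (simp add: f_eq sD s'D del: restrict_apply)
  qed simp
  have "s' r = s r \<oplus> ?f [r]" if "r \<in> carrier R" for r
    unfolding f_eq[OF that] using sD(1)[OF that] s'D(1)[OF that] by algebra
  then have "factor_set A R s' = hochschild_d R M (Suc 0) ?f \<otimes>\<^bsub>cochain_group R M 2\<^esub> factor_set A R s"
    by (rule factor_set_twist[OF s s' f])
  moreover have "hochschild_d R M (Suc 0) ?f \<in> coboundaries R M 2"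
    unfolding coboundaries_2 using f by (rule imageI)
  \<comment> \<open>Membership in the coset of the other factor set is enough, as cosets with a
    common element coincide.\<close>
  ultimately have "factor_set A R s' \<in> coboundaries R M 2 #>\<^bsub>cochain_group R M 2\<^esub> factor_set A R s"
    by (auto simp: r_coset_def)
  then show ?thesis
    unfolding HH_class_eq
    using factor_set_cochain[OF s]
    by (intro group.repr_independence[OF group_cochains] coboundaries_subgroup)
      (simp_all add: cochain_group_simps)
qed

section \<open>Ring sections, vanishing of the class and splittings\<close>

lemma ring_section_factor_set:
  assumes t: "ring_section A R p t"
  shows "factor_set A R t \<in> coboundaries R M 2"
proof -
  have t_hom: "t \<in> ring_hom R A"
    using t by (simp add: ring_section_def)
  have "factor_set A R t [x, y] = \<zero>" if "x \<in> carrier R" "y \<in> carrier R" for x y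
    using that t_hom by (simp add: factor_set_eq ring_hom_mult ring_hom_closed a_minus_def r_neg)
  then have "factor_set A R t = \<one>\<^bsub>cochain_group R M 2\<^esub>"
    unfolding cochain_group_simps
    by (intro extensionalityI[of _ "tuples R 2"]) (auto simp: tuples_2_iff factor_set_def)
  then show ?thesis
    using subgroup.one_closed[OF coboundaries_subgroup] by simp
qed

lemma coboundary_imp_ring_section:
  assumes s: "additive_section A R p s" and cob: "factor_set A R s \<in> coboundaries R M 2"
  shows "\<exists>t. ring_section A R p t"
proof -
  note sD = additive_sectionD[OF s]
  obtain g where g: "g \<in> cochains R M (Suc 0)" and \<omega>: "factor_set A R s = hochschild_d R M (Suc 0) g"
    using cob by (auto simp: coboundaries_2)
  note gK = cochain_1_in_K[OF g]
  \<comment> \<open>The equation between factor set and coboundary, read in \<open>A\<close> with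
    \<open>s x\<close> and \<open>s y\<close> as lifts.\<close>
  have rel: "s x \<otimes> s y \<ominus> s (x \<otimes>\<^bsub>R\<^esub> y) = s x \<otimes> g [y] \<ominus> g [x \<otimes>\<^bsub>R\<^esub> y] \<oplus> g [x] \<otimes> s y"
    if "x \<in> carrier R" "y \<in> carrier R" for x y
    using that hochschild_d_1[OF g sD(1)[OF that(1)] sD(1)[OF that(2)]] sD(1)
    by (simp add: factor_set_eq sD flip: \<omega>)
  let ?t = "\<lambda>r. s r \<ominus> g [r]"
  \<comment> \<open>With both arguments equal to one, the left side of \<open>rel\<close> is zero
    because \<open>s\<close> is unital, while the right side reduces to a single copy of the value
    of \<open>g\<close> at one. So \<open>?t\<close> is unital too.\<close>
  have g1: "g [\<one>\<^bsub>R\<^esub>] = \<zero>"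
    using rel[of "\<one>\<^bsub>R\<^esub>" "\<one>\<^bsub>R\<^esub>"] K_carrier[OF gK[OF R.one_closed]]
    by (simp add: sD a_minus_def r_neg)
  have "?t \<in> ring_hom R A"
  proof (rule ring_hom_memI)
    fix x y
    assume x: "x \<in> carrier R" and y: "y \<in> carrier R"
    let ?xy = "x \<otimes>\<^bsub>R\<^esub> y"
    have xy: "?xy \<in> carrier R"
      using x y by simp
    have car: "s x \<in> carrier A" "s y \<in> carrier A" "s ?xy \<in> carrier A"
        "g [x] \<in> carrier A" "g [y] \<in> carrier A" "g [?xy] \<in> carrier A"
      using x y xy by (simp_all add: sD K_carrier gK)
    show "?t x \<in> carrier A"
      using car by simp
    have "(s x \<oplus> s y) \<ominus> (g [x] \<oplus> g [y]) = (s x \<ominus> g [x]) \<oplus> (s y \<ominus> g [y])"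
      using car by algebra
    then show "?t (x \<oplus>\<^bsub>R\<^esub> y) = ?t x \<oplus> ?t y"
      using x y by (simp add: sD cochain_1_add[OF g])
    \<comment> \<open>The bracket reproduces the right side of \<open>rel\<close> and is replaced
      below by the factor set of \<open>s\<close>; the last term is a product of two elements of
      \<open>K\<close>.\<close>
    have "(s x \<ominus> g [x]) \<otimes> (s y \<ominus> g [y]) =
        s x \<otimes> s y \<ominus> (s x \<otimes> g [y] \<ominus> g [?xy] \<oplus> g [x] \<otimes> s y) \<ominus> g [?xy] \<oplus> g [x] \<otimes> g [y]"
      using car by algebra
    also have "g [x] \<otimes> g [y] = \<zero>"
      using x y by (intro square_zero gK)
    also have "s x \<otimes> g [y] \<ominus> g [?xy] \<oplus> g [x] \<otimes> s y = s x \<otimes> s y \<ominus> s ?xy"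
      using rel[OF x y] by simp
    also have "s x \<otimes> s y \<ominus> (s x \<otimes> s y \<ominus> s ?xy) \<ominus> g [?xy] \<oplus> \<zero> = s ?xy \<ominus> g [?xy]"
      using car by algebra
    finally show "?t ?xy = ?t x \<otimes> ?t y"
      by simp
  next
    show "?t \<one>\<^bsub>R\<^esub> = \<one>"
      by (simp add: g1 sD a_minus_def)
  qed
  moreover have "p (?t r) = r" if "r \<in> carrier R" for r
    using that gK[OF that] by (simp add: sD K_iff a_minus_def)
  ultimately show ?thesis
    unfolding ring_section_def by blast
qed

lemma ring_section_imp_split:
  assumes t: "ring_section A R p t"
  shows "\<exists>\<phi>\<in>ring_iso A (split_extension R M). (\<forall>k\<in>K. \<phi> k = (\<zero>\<^bsub>R\<^esub>, k)) \<and>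
    (\<forall>a\<in>carrier A. fst (\<phi> a) = p a)"
proof
  have t_hom: "t \<in> ring_hom R A" and pt: "\<And>r. r \<in> carrier R \<Longrightarrow> p (t r) = r"
    using t by (simp_all add: ring_section_def)
  interpret t: ring_hom_ring R A t
    by (intro ring_hom_ringI2 t_hom A.ring_axioms R.ring_axioms)
  let ?\<phi> = "\<lambda>a. (p a, a \<ominus> t (p a))"
  have tK: "a \<ominus> t (p a) \<in> K" if "a \<in> carrier A" for a
    using that by (intro diff_in_K) (simp_all add: pt)
  show "?\<phi> \<in> ring_iso A (split_extension R M)"
  proof (rule ring_iso_memI)
    fix a b
    assume a: "a \<in> carrier A" and b: "b \<in> carrier A"
    have car: "t (p a) \<in> carrier A" "t (p b) \<in> carrier A"
      using a b by simp_all
    show "?\<phi> a \<in> carrier (split_extension R M)"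
      using a tK[OF a] by (simp add: split_extension_def)
    \<comment> \<open>A telescoping arranged so that each summand is an action on \<open>K\<close>:
      on the left \<open>p a\<close> is lifted by \<open>t (p a)\<close>, on the right
      \<open>p b\<close> is lifted by \<open>b\<close> itself.\<close>
    have "a \<otimes> b \<ominus> t (p a) \<otimes> t (p b) = t (p a) \<otimes> (b \<ominus> t (p b)) \<oplus> (a \<ominus> t (p a)) \<otimes> b"
      using a b car by algebra
    also have "t (p a) \<otimes> (b \<ominus> t (p b)) = lact M (p a) (b \<ominus> t (p b))"
      using lact_lift[OF car(1) tK[OF b]] a by (simp add: pt)
    also have "(a \<ominus> t (p a)) \<otimes> b = ract M (a \<ominus> t (p a)) (p b)"
      using ract_lift[OF b tK[OF a]] by simp
    finally show "?\<phi> (a \<otimes> b) = ?\<phi> a \<otimes>\<^bsub>split_extension R M\<^esub> ?\<phi> b"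
      using a b by (simp add: split_extension_def)
    have "a \<oplus> b \<ominus> (t (p a) \<oplus> t (p b)) = (a \<ominus> t (p a)) \<oplus> (b \<ominus> t (p b))"
      using a b car by algebra
    then show "?\<phi> (a \<oplus> b) = ?\<phi> a \<oplus>\<^bsub>split_extension R M\<^esub> ?\<phi> b"
      using a b by (simp add: split_extension_def)
  next
    show "?\<phi> \<one> = \<one>\<^bsub>split_extension R M\<^esub>"
      by (simp add: split_extension_def a_minus_def r_neg)
    have "inj_on ?\<phi> (carrier A)"
    proof (rule inj_onI)
      fix a b
      assume a: "a \<in> carrier A" and b: "b \<in> carrier A" and eq: "?\<phi> a = ?\<phi> b"
      then have "p a = p b" and "a \<ominus> t (p a) = b \<ominus> t (p b)"
        by blast+
      then have "a \<ominus> t (p b) = b \<ominus> t (p b)"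
        by (rule subst)
      then show "a = b"
        using a b by (simp add: a_minus_def)
    qed
    moreover have "?\<phi> ` carrier A = carrier (split_extension R M)"
    proof
      show "?\<phi> ` carrier A \<subseteq> carrier (split_extension R M)"
        using tK by (auto simp: split_extension_def)
      show "carrier (split_extension R M) \<subseteq> ?\<phi> ` carrier A"
      proof
        fix v
        assume "v \<in> carrier (split_extension R M)"
        then obtain r k where v: "v = (r, k)" and r: "r \<in> carrier R" and k: "k \<in> K"
          by (auto simp: split_extension_def)
        \<comment> \<open>The preimage of \<open>(r, k)\<close> is
          \<open>t r \<oplus> k\<close>.\<close>
        have pe: "p (t r \<oplus> k) = r"
          using r k by (simp add: pt K_iff)
        have "t r \<oplus> k \<ominus> t r = k"
          using t.hom_closed[OF r] K_carrier[OF k] by algebra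
        then have "?\<phi> (t r \<oplus> k) = v"
          by (simp add: v pe)
        moreover have "t r \<oplus> k \<in> carrier A"
          using r K_carrier[OF k] by simp
        ultimately show "v \<in> ?\<phi> ` carrier A"
          by blast
      qed
    qed
    ultimately show "bij_betw ?\<phi> (carrier A) (carrier (split_extension R M))"
      by (simp add: bij_betw_def)
  qed
  show "(\<forall>k\<in>K. ?\<phi> k = (\<zero>\<^bsub>R\<^esub>, k)) \<and> (\<forall>a\<in>carrier A. fst (?\<phi> a) = p a)"
    by (simp add: K_iff a_minus_def)
qed

lemma split_imp_ring_section:
  assumes \<phi>: "\<phi> \<in> ring_iso A (split_extension R M)" and fst: "\<And>a. a \<in> carrier A \<Longrightarrow> fst (\<phi> a) = p a"
  shows "\<exists>t. ring_section A R p t"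
proof -
  let ?E = "split_extension R M"
  let ?\<psi> = "inv_into (carrier A) \<phi>"
  have \<psi>: "?\<psi> \<in> ring_hom ?E A"
    using ring_iso_set_sym[OF A.ring_axioms \<phi>] by (simp add: ring_iso_def)
  \<comment> \<open>These are the cross terms in a product of \<open>(r, \<zero>)\<close> and
    \<open>(r', \<zero>)\<close>; their vanishing makes the embedding of \<open>R\<close>
    multiplicative.\<close>
  have act_zero: "lact M r \<zero> = \<zero>" "ract M \<zero> r = \<zero>" if r: "r \<in> carrier R" for r
  proof -
    obtain a where "a \<in> carrier A" "p a = r"
      using r by (rule lift_exists)
    then show "lact M r \<zero> = \<zero>" "ract M \<zero> r = \<zero>"
      using lact_lift[of a \<zero>] ract_lift[of a \<zero>] by auto
  qed
  have "(\<lambda>r. (r, \<zero>)) \<in> ring_hom R ?E"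
    by (rule ring_hom_memI) (simp_all add: split_extension_def act_zero)
  then have "?\<psi> \<circ> (\<lambda>r. (r, \<zero>)) \<in> ring_hom R A"
    using \<psi> by (rule ring_hom_trans)
  moreover have "p ((?\<psi> \<circ> (\<lambda>r. (r, \<zero>))) r) = r" if "r \<in> carrier R" for r
  proof -
    have "(r, \<zero>) \<in> \<phi> ` carrier A"
      using \<phi> that by (simp add: ring_iso_def bij_betw_def split_extension_def)
    then have "?\<psi> (r, \<zero>) \<in> carrier A" "\<phi> (?\<psi> (r, \<zero>)) = (r, \<zero>)"
      by (rule inv_into_into, rule f_inv_into_f)
    then show ?thesis
      using fst[of "?\<psi> (r, \<zero>)"] by simp
  qed
  ultimately show ?thesis
    unfolding ring_section_def by blast
qed

lemma ring_section_iff_split: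
  "(\<exists>t. ring_section A R p t) \<longleftrightarrow>
    (\<exists>\<phi>\<in>ring_iso A (split_extension R M). (\<forall>k\<in>K. \<phi> k = (\<zero>\<^bsub>R\<^esub>, k)) \<and>
      (\<forall>a\<in>carrier A. fst (\<phi> a) = p a))"
  using ring_section_imp_split split_imp_ring_section by blast

text \<open>For the converse, independence of the section allows the class to be computed from the
  ring section, whose factor set is zero.\<close>

lemma HH_class_factor_set_trivial_iff:
  assumes s: "additive_section A R p s"
  shows "HH_class R M 2 (factor_set A R s) = \<one>\<^bsub>HH R M 2\<^esub> \<longleftrightarrow> (\<exists>t. ring_section A R p t)"
proof
  assume "HH_class R M 2 (factor_set A R s) = \<one>\<^bsub>HH R M 2\<^esub>"
  then show "\<exists>t. ring_section A R p t"
    using coboundary_imp_ring_section[OF s] HH_class_one_iff[OF factor_set_cochain[OF s]] by simp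
next
  assume "\<exists>t. ring_section A R p t"
  then obtain t where t: "ring_section A R p t" ..
  note t' = ring_section_additive_section[OF t]
  show "HH_class R M 2 (factor_set A R s) = \<one>\<^bsub>HH R M 2\<^esub>"
    unfolding HH_class_factor_set_unique[OF s t'] HH_class_one_iff[OF factor_set_cochain[OF t']]
    using t by (rule ring_section_factor_set)
qed

end

section \<open>The regular representation of a ternary ring\<close>

text \<open>The product of \<open>free_rng\<close> nests two extensions, with the right factor
  inside the function that the outer one extends; additivity in that factor rests on this.\<close>

lemma frag_extend_fun_diff:
  "frag_extend (\<lambda>p. f p - g p) w = frag_extend f w - frag_extend g w"
  unfolding frag_extend_def sum_subtractf[symmetric]
  by (intro sum.cong refl poly_mapping_eqI) (simp add: lookup_minus right_diff_distrib)

lemma frag_extend_fun_zero: "frag_extend (\<lambda>p. 0) w = 0"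
  by (simp add: frag_extend_def)

text \<open>Identities additive in \<open>c\<close> thereby need checking on generators only; the
  product and \<open>rho_free\<close> are mostly treated this way.\<close>

lemma frag_induct [case_names zero one diff]:
  assumes "P 0" and "\<And>x. P (frag_of x)" and "\<And>a b. P a \<Longrightarrow> P b \<Longrightarrow> P (a - b)"
  shows "P c"
  using subset_UNIV assms by (rule frag_induction)

lemma subgroup_free_Abelian_groupI:
  assumes "0 \<in> H" and diff: "\<And>v w. v \<in> H \<Longrightarrow> w \<in> H \<Longrightarrow> v - w \<in> H"
  shows "subgroup H (free_Abelian_group UNIV)"
proof
  show "H \<subseteq> carrier (free_Abelian_group UNIV)" "\<one>\<^bsub>free_Abelian_group UNIV\<^esub> \<in> H"
    using assms(1) by auto
  show "v \<otimes>\<^bsub>free_Abelian_group UNIV\<^esub> w \<in> H" if "v \<in> H" "w \<in> H" for v w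
    using diff[OF that(1) diff[OF assms(1) that(2)]] by simp
  show "inv\<^bsub>free_Abelian_group UNIV\<^esub> v \<in> H" if "v \<in> H" for v
    using diff[OF assms(1) that] by simp
qed

lemma (in abelian_group) finsum_frag_of:
  assumes "g p \<in> carrier G"
  shows "(\<Oplus>q\<in>Poly_Mapping.keys (frag_of p). add_pow G (Poly_Mapping.lookup (frag_of p) q) (g q)) = g p"
  using assms by (simp add: add.int_pow_1)

text \<open>The range of summation varies with the element, and cancellation may make the support of
  \<open>v + w\<close> smaller than the union of the two supports. All three sums are therefore
  extended to that union, where the extra coefficients are zero.\<close>

lemma (in abelian_group) finsum_frag_add:
  fixes v w :: "'c \<Rightarrow>\<^sub>0 int"
  assumes g: "\<And>p. g p \<in> carrier G"
  defines "\<Phi> \<equiv> \<lambda>u :: 'c \<Rightarrow>\<^sub>0 int. \<Oplus>p\<in>Poly_Mapping.keys u. add_pow G (Poly_Mapping.lookup u p) (g p)"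
  shows "\<Phi> (v + w) = \<Phi> v \<oplus> \<Phi> w"
proof -
  have \<Phi>: "\<Phi> u = (\<Oplus>p\<in>S. add_pow G (Poly_Mapping.lookup u p) (g p))"
    if "finite S" "Poly_Mapping.keys u \<subseteq> S" for u S
    unfolding \<Phi>_def using that g
    by (intro add.finprod_mono_neutral_cong_left) (auto simp: in_keys_iff add_pow_int_ge)
  let ?S = "Poly_Mapping.keys v \<union> Poly_Mapping.keys w"
  have "\<Phi> (v + w) = (\<Oplus>p\<in>?S. add_pow G (Poly_Mapping.lookup v p) (g p) \<oplus> add_pow G (Poly_Mapping.lookup w p) (g p))"
    using g by (simp add: \<Phi>[of ?S] keys_add lookup_add add.int_pow_mult)
  also have "\<dots> = \<Phi> v \<oplus> \<Phi> w"
    using g by (simp add: \<Phi>[of ?S v] \<Phi>[of ?S w] finsum_addf)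
  finally show ?thesis .
qed

section \<open>The ring on the free abelian group of quadruples, and the endomorphism ring\<close>

lemma rng_free_additive_group: "add_monoid (free_rng tri) = free_Abelian_group UNIV"
  by (simp add: free_rng_def free_Abelian_group_def)

lemma free_rng_simps:
  "carrier (free_rng tri) = UNIV" "v \<oplus>\<^bsub>free_rng tri\<^esub> w = v + w" "\<zero>\<^bsub>free_rng tri\<^esub> = 0"
  by (simp_all add: free_rng_def)

lemma free_rng_mult_of: "frag_of p \<otimes>\<^bsub>free_rng tri\<^esub> frag_of q = frag_of (quad_mult tri p q)"
  by (simp add: free_rng_def)

lemma free_rng_mult_zero: "v \<otimes>\<^bsub>free_rng tri\<^esub> 0 = 0" "0 \<otimes>\<^bsub>free_rng tri\<^esub> v = 0"
  by (simp_all add: free_rng_def frag_extend_fun_zero)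

lemma free_rng_mult_diff:
  "u \<otimes>\<^bsub>free_rng tri\<^esub> (v - w) = u \<otimes>\<^bsub>free_rng tri\<^esub> v - u \<otimes>\<^bsub>free_rng tri\<^esub> w"
  "(v - w) \<otimes>\<^bsub>free_rng tri\<^esub> u = v \<otimes>\<^bsub>free_rng tri\<^esub> u - w \<otimes>\<^bsub>free_rng tri\<^esub> u"
  by (simp_all add: free_rng_def frag_extend_diff frag_extend_fun_diff)

lemma free_rng_mult_add:
  "u \<otimes>\<^bsub>free_rng tri\<^esub> (v + w) = u \<otimes>\<^bsub>free_rng tri\<^esub> v + u \<otimes>\<^bsub>free_rng tri\<^esub> w"
  "(v + w) \<otimes>\<^bsub>free_rng tri\<^esub> u = v \<otimes>\<^bsub>free_rng tri\<^esub> u + w \<otimes>\<^bsub>free_rng tri\<^esub> u"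
  \<comment> \<open>The sum \<open>v + w\<close> is treated as the difference
    \<open>v - (0 - w)\<close>.\<close>
  using free_rng_mult_diff(1)[of tri u v "0 - w"] free_rng_mult_diff(1)[of tri u 0 w]
    free_rng_mult_diff(2)[of tri v "0 - w" u] free_rng_mult_diff(2)[of tri 0 w u]
  by (simp_all add: free_rng_mult_zero)

lemma additive_iff: "Modules.additive f \<longleftrightarrow> (\<forall>x y. f (x + y) = f x + f y)"
  by (simp add: additive_def)

lemma End_ring_simps:
  "f \<in> carrier End_ring \<longleftrightarrow> Modules.additive f" "f \<otimes>\<^bsub>End_ring\<^esub> g = f \<circ> g"
  "\<one>\<^bsub>End_ring\<^esub> = id" "f \<oplus>\<^bsub>End_ring\<^esub> g = (\<lambda>x. f x + g x)" "\<zero>\<^bsub>End_ring\<^esub> = (\<lambda>_. 0)"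
  by (simp_all add: End_ring_def)

lemma ring_End_ring: "ring (End_ring :: ('t::ab_group_add \<Rightarrow> 't) ring)"
proof (rule ringI)
  show "abelian_group (End_ring :: ('t \<Rightarrow> 't) ring)"
  proof (rule abelian_groupI)
    fix f :: "'t \<Rightarrow> 't"
    assume "f \<in> carrier End_ring"
    then show "\<exists>g\<in>carrier End_ring. g \<oplus>\<^bsub>End_ring\<^esub> f = \<zero>\<^bsub>End_ring\<^esub>"
      by (intro bexI[of _ "\<lambda>x. - f x"]) (simp_all add: End_ring_simps additive_iff)
  qed (auto simp: End_ring_simps additive_iff algebra_simps)
  show "Group.monoid (End_ring :: ('t \<Rightarrow> 't) ring)"
    by (rule monoidI) (auto simp: End_ring_simps additive_iff)
qed (auto simp: End_ring_simps additive_iff)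

text \<open>A kernel depends on its target only through the zero, which is the same after shrinking
  the carrier to the image.\<close>

lemma defect_eq_kernel: "defect tri = a_kernel (A_ring tri) (R_ring tri) (rho_hat tri)"
  by (simp add: defect_def R_ring_def a_kernel_def')

context ternary_gamma_ring
begin

lemma tri_add [simp]:
  "tri (x + x') \<alpha> y \<beta> z = tri x \<alpha> y \<beta> z + tri x' \<alpha> y \<beta> z"
  "tri x (\<alpha> + \<alpha>') y \<beta> z = tri x \<alpha> y \<beta> z + tri x \<alpha>' y \<beta> z"
  "tri x \<alpha> (y + y') \<beta> z = tri x \<alpha> y \<beta> z + tri x \<alpha> y' \<beta> z"
  "tri x \<alpha> y (\<beta> + \<beta>') z = tri x \<alpha> y \<beta> z + tri x \<alpha> y \<beta>' z"
  "tri x \<alpha> y \<beta> (z + z') = tri x \<alpha> y \<beta> z + tri x \<alpha> y \<beta> z'"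
  by (rule additive.add[OF additive_1] additive.add[OF additive_2] additive.add[OF additive_3]
      additive.add[OF additive_4] additive.add[OF additive_5])+

lemma quad_mult_assoc: "quad_mult tri (quad_mult tri p q) r = quad_mult tri p (quad_mult tri q r)"
  by (cases p; cases q; cases r) (simp add: assoc_left assoc_right)

sublocale free: rng "free_rng tri"
proof (intro rng.intro rng_axioms.intro comm_group_abelian_groupI)
  show "comm_group (add_monoid (free_rng tri))"
    unfolding rng_free_additive_group by (rule abelian_free_Abelian_group)
next
  fix u v w
  \<comment> \<open>Associativity is additive in each of the three factors, so they are reduced to
    generators one at a time, beginning with the rightmost.\<close>
  have "frag_of p \<otimes>\<^bsub>free_rng tri\<^esub> frag_of q \<otimes>\<^bsub>free_rng tri\<^esub> w =
      frag_of p \<otimes>\<^bsub>free_rng tri\<^esub> (frag_of q \<otimes>\<^bsub>free_rng tri\<^esub> w)" for p q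
    by (induction w rule: frag_induct)
      (simp_all add: free_rng_mult_of free_rng_mult_zero free_rng_mult_diff quad_mult_assoc)
  then have "frag_of p \<otimes>\<^bsub>free_rng tri\<^esub> v \<otimes>\<^bsub>free_rng tri\<^esub> w =
      frag_of p \<otimes>\<^bsub>free_rng tri\<^esub> (v \<otimes>\<^bsub>free_rng tri\<^esub> w)" for p
    by (induction v rule: frag_induct) (simp_all add: free_rng_mult_zero free_rng_mult_diff)
  then show "u \<otimes>\<^bsub>free_rng tri\<^esub> v \<otimes>\<^bsub>free_rng tri\<^esub> w = u \<otimes>\<^bsub>free_rng tri\<^esub> (v \<otimes>\<^bsub>free_rng tri\<^esub> w)"
    by (induction u rule: frag_induct) (simp_all add: free_rng_mult_zero free_rng_mult_diff)
qed (simp_all add: free_rng_simps free_rng_mult_add)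

section \<open>The subgroup of multilinearity relations as an ideal\<close>

lemma multilin_relsI:
  "frag_of (a + a', \<alpha>, b, \<beta>) - frag_of (a, \<alpha>, b, \<beta>) - frag_of (a', \<alpha>, b, \<beta>) \<in> multilin_rels"
  "frag_of (a, \<alpha> + \<alpha>', b, \<beta>) - frag_of (a, \<alpha>, b, \<beta>) - frag_of (a, \<alpha>', b, \<beta>) \<in> multilin_rels"
  "frag_of (a, \<alpha>, b + b', \<beta>) - frag_of (a, \<alpha>, b, \<beta>) - frag_of (a, \<alpha>, b', \<beta>) \<in> multilin_rels"
  "frag_of (a, \<alpha>, b, \<beta> + \<beta>') - frag_of (a, \<alpha>, b, \<beta>) - frag_of (a, \<alpha>, b, \<beta>') \<in> multilin_rels"
  unfolding multilin_rels_def by blast+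

lemma multilin_relsE:
  assumes "r \<in> multilin_rels"
  obtains
    (1) a a' \<alpha> b \<beta> where "r = frag_of (a + a', \<alpha>, b, \<beta>) - frag_of (a, \<alpha>, b, \<beta>) - frag_of (a', \<alpha>, b, \<beta>)"
  | (2) a \<alpha> \<alpha>' b \<beta> where "r = frag_of (a, \<alpha> + \<alpha>', b, \<beta>) - frag_of (a, \<alpha>, b, \<beta>) - frag_of (a, \<alpha>', b, \<beta>)"
  | (3) a \<alpha> b b' \<beta> where "r = frag_of (a, \<alpha>, b + b', \<beta>) - frag_of (a, \<alpha>, b, \<beta>) - frag_of (a, \<alpha>, b', \<beta>)"
  | (4) a \<alpha> b \<beta> \<beta>' where "r = frag_of (a, \<alpha>, b, \<beta> + \<beta>') - frag_of (a, \<alpha>, b, \<beta>) - frag_of (a, \<alpha>, b, \<beta>')"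
  using assms unfolding multilin_rels_def by blast

text \<open>Multiplying a relation on the left by a quadruple changes only its first entry,
  additively, and keeps the kind of relation. On the right, the whole quadruple is absorbed into a
  first entry, so all four kinds become relations in the first slot.\<close>

lemma multilin_rels_mult:
  assumes "r \<in> multilin_rels"
  shows "frag_of q \<otimes>\<^bsub>free_rng tri\<^esub> r \<in> multilin_rels" "r \<otimes>\<^bsub>free_rng tri\<^esub> frag_of q \<in> multilin_rels"
  using assms
  by (cases q, cases r rule: multilin_relsE;
      simp add: free_rng_mult_diff free_rng_mult_of multilin_relsI)+

lemma subgroup_multilin_subgroup: "subgroup multilin_subgroup (free_Abelian_group UNIV)"
  unfolding multilin_subgroup_def by (intro group.generate_is_subgroup) auto

lemma multilin_subgroup_zero: "0 \<in> multilin_subgroup"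
  using subgroup.one_closed[OF subgroup_multilin_subgroup] by simp

lemma multilin_subgroup_diff:
  assumes "v \<in> multilin_subgroup" "w \<in> multilin_subgroup"
  shows "v - w \<in> multilin_subgroup"
  using subgroup.m_closed[OF subgroup_multilin_subgroup assms(1)
      subgroup.m_inv_closed[OF subgroup_multilin_subgroup assms(2)]] by simp

lemma multilin_rels_subset: "multilin_rels \<subseteq> multilin_subgroup"
  unfolding multilin_subgroup_def by (auto intro: generate.incl)

lemma multilin_subgroup_least:
  assumes "multilin_rels \<subseteq> H" "subgroup H (free_Abelian_group UNIV)"
  shows "multilin_subgroup \<subseteq> H"
  unfolding multilin_subgroup_def using assms by (intro group.generate_subgroup_incl) auto

lemma rng_ideal_multilin_subgroup: "rng_ideal (free_rng tri) multilin_subgroup"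
proof -
  \<comment> \<open>For a fixed quadruple \<open>q\<close>, the elements whose products with
    \<open>q\<close> on both sides are in \<open>multilin_subgroup\<close> form a subgroup
    containing the relations.\<close>
  have of: "multilin_subgroup \<subseteq>
      {r. frag_of q \<otimes>\<^bsub>free_rng tri\<^esub> r \<in> multilin_subgroup \<and> r \<otimes>\<^bsub>free_rng tri\<^esub> frag_of q \<in> multilin_subgroup}" for q
    using multilin_rels_mult[of _ q] multilin_rels_subset
    by (intro multilin_subgroup_least subgroup_free_Abelian_groupI)
      (auto simp: free_rng_mult_zero free_rng_mult_diff multilin_subgroup_zero multilin_subgroup_diff)
  have "x \<otimes>\<^bsub>free_rng tri\<^esub> r \<in> multilin_subgroup \<and> r \<otimes>\<^bsub>free_rng tri\<^esub> x \<in> multilin_subgroup"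
    if r: "r \<in> multilin_subgroup" for x r
  proof (induction x rule: frag_induct)
    case (one q)
    show ?case
      using of[of q] r by blast
  qed (simp_all add: free_rng_mult_zero free_rng_mult_diff multilin_subgroup_zero multilin_subgroup_diff)
  moreover have "additive_subgroup multilin_subgroup (free_rng tri)"
    unfolding additive_subgroup_def rng_free_additive_group by (rule subgroup_multilin_subgroup)
  ultimately show ?thesis
    by (simp add: rng_ideal_def)
qed

sublocale F: rng "F_rng tri"
  unfolding F_rng_def by (rule free.rng_Quot) (rule rng_ideal_multilin_subgroup)

section \<open>The regular representation, passed through the two quotients\<close>

interpretation End: ring "End_ring :: ('t \<Rightarrow> 't) ring"
  by (rule ring_End_ring)

lemma tri_in_End: "tri a \<alpha> b \<beta> \<in> carrier End_ring"
  by (simp add: End_ring_simps additive_5)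

lemma rho_free_add: "rho_free tri (v + w) = (\<lambda>x. rho_free tri v x + rho_free tri w x)"
  using End.finsum_frag_add[of "\<lambda>p. case p of (a, \<alpha>, b, \<beta>) \<Rightarrow> tri a \<alpha> b \<beta>" v w] tri_in_End
  by (simp add: rho_free_def End_ring_simps(4) split: prod.split)

lemma rho_free_of: "rho_free tri (frag_of (a, \<alpha>, b, \<beta>)) = tri a \<alpha> b \<beta>"
  using End.finsum_frag_of[of "\<lambda>p. case p of (a, \<alpha>, b, \<beta>) \<Rightarrow> tri a \<alpha> b \<beta>" "(a, \<alpha>, b, \<beta>)"] tri_in_End
  by (simp add: rho_free_def)

lemma rho_free_diff: "rho_free tri (v - w) = (\<lambda>x. rho_free tri v x - rho_free tri w x)"
proof
  show "rho_free tri (v - w) x = rho_free tri v x - rho_free tri w x" for x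
    using fun_cong[OF rho_free_add[of "v - w" w], of x] by simp
qed

lemma rho_free_zero: "rho_free tri 0 = (\<lambda>x. 0)"
  using rho_free_diff[of 0 0] by simp

lemma additive_rho_free: "Modules.additive (rho_free tri w)"
proof (induction w rule: frag_induct)
  case (one p)
  then show ?case
    by (cases p) (simp add: rho_free_of additive_5)
qed (simp_all add: rho_free_zero rho_free_diff additive_iff)

text \<open>On generators this is the associativity of the ternary product. Reducing the right
  factor to generators also uses that the values of \<open>rho_free\<close> are additive maps, so
  that composing with them on the left respects differences.\<close>

lemma rho_free_mult: "rho_free tri (v \<otimes>\<^bsub>free_rng tri\<^esub> w) = rho_free tri v \<circ> rho_free tri w"
proof -
  have "rho_free tri (frag_of p \<otimes>\<^bsub>free_rng tri\<^esub> w) = rho_free tri (frag_of p) \<circ> rho_free tri w" for p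
  proof (induction w rule: frag_induct)
    case (one q)
    show ?case
      by (cases p; cases q) (auto simp: free_rng_mult_of rho_free_of assoc_left assoc_right)
  qed (auto simp: free_rng_mult_zero free_rng_mult_diff rho_free_zero rho_free_diff
      additive.zero[OF additive_rho_free] additive.diff[OF additive_rho_free])
  then show ?thesis
    by (induction v rule: frag_induct)
      (auto simp: free_rng_mult_zero free_rng_mult_diff rho_free_zero rho_free_diff)
qed

lemma rho_free_hom: "rho_free tri \<in> rng_hom (free_rng tri) End_ring"
  by (rule rng_homI)
    (simp_all add: End_ring_simps additive_rho_free rho_free_mult free_rng_simps rho_free_add)

text \<open>The four kinds of relation vanish by additivity of \<open>tri\<close> in its first four
  variables.\<close>

lemma multilin_subgroup_kernel: "multilin_subgroup \<subseteq> a_kernel (free_rng tri) End_ring (rho_free tri)"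
proof (rule multilin_subgroup_least)
  show "multilin_rels \<subseteq> a_kernel (free_rng tri) End_ring (rho_free tri)"
    unfolding multilin_rels_def a_kernel_def'
    by (auto simp: free_rng_simps End_ring_simps rho_free_diff rho_free_of)
  show "subgroup (a_kernel (free_rng tri) End_ring (rho_free tri)) (free_Abelian_group UNIV)"
    unfolding a_kernel_def'
    by (rule subgroup_free_Abelian_groupI)
      (auto simp: free_rng_simps End_ring_simps rho_free_diff rho_free_zero)
qed

lemma rho_F_hom: "rho_F tri \<in> rng_hom (F_rng tri) End_ring"
proof -
  have "rho_F tri = (\<lambda>V. the_elem (rho_free tri ` V))"
    by (rule ext) (simp add: rho_F_def)
  then show ?thesis
    unfolding F_rng_def
    using free.the_elem_image_rng_hom[OF End.rng rho_free_hom rng_ideal_multilin_subgroup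
        multilin_subgroup_kernel] by simp
qed

lemma pure_tensor_carrier: "pure_tensor tri a \<alpha> b \<beta> \<in> carrier (F_rng tri)"
  by (simp add: pure_tensor_def F_rng_def free.Quot_carrier free_rng_simps)

lemma rho_F_pure_tensor: "rho_F tri (pure_tensor tri a \<alpha> b \<beta>) = tri a \<alpha> b \<beta>"
  unfolding rho_F_def pure_tensor_def
  using free.the_elem_image_rcoset[OF End.rng rho_free_hom rng_ideal_multilin_subgroup
      multilin_subgroup_kernel, of "frag_of (a, \<alpha>, b, \<beta>)"]
  by (simp add: free_rng_simps rho_free_of)

lemma J_generators_carrier:
  "{pure_tensor tri (tri a \<alpha> b \<beta> c) \<gamma> d \<delta> \<ominus>\<^bsub>F_rng tri\<^esub> pure_tensor tri a \<alpha> (tri b \<beta> c \<gamma> d) \<delta>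
     | a \<alpha> b \<beta> c \<gamma> d \<delta>. True} \<subseteq> carrier (F_rng tri)"
  using pure_tensor_carrier by auto

lemma rng_ideal_J: "rng_ideal (F_rng tri) (J_ideal tri)"
  unfolding J_ideal_def by (rule F.rng_ideal_genideal[OF J_generators_carrier])

text \<open>The kernel is an ideal, so it suffices to treat the generators; these are killed by the
  first of the two associativity laws, \<open>assoc_left\<close>.\<close>

lemma J_ideal_kernel: "J_ideal tri \<subseteq> a_kernel (F_rng tri) End_ring (rho_F tri)"
  unfolding J_ideal_def
proof (rule F.rng_genideal_minimal[OF F.rng_ideal_a_kernel[OF End.rng rho_F_hom]], clarify)
  fix a \<alpha> b \<beta> c \<gamma> d \<delta>
  let ?u = "pure_tensor tri (tri a \<alpha> b \<beta> c) \<gamma> d \<delta>" and ?v = "pure_tensor tri a \<alpha> (tri b \<beta> c \<gamma> d) \<delta>"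
  interpret h: abelian_group_hom "F_rng tri" End_ring "rho_F tri"
    by (rule rng_hom_abelian_group_hom[OF F.rng_axioms End.rng rho_F_hom])
  have eq: "rho_F tri ?u = rho_F tri ?v"
    by (auto simp: rho_F_pure_tensor assoc_left)
  have "rho_F tri (?u \<ominus>\<^bsub>F_rng tri\<^esub> ?v) = rho_F tri ?u \<ominus>\<^bsub>End_ring\<^esub> rho_F tri ?v"
    unfolding a_minus_def
    using pure_tensor_carrier by (simp only: h.hom_add h.hom_a_inv F.a_inv_closed)
  also have "\<dots> = \<zero>\<^bsub>End_ring\<^esub>"
    unfolding eq a_minus_def by (rule End.r_neg) (rule h.hom_closed[OF pure_tensor_carrier])
  finally show "?u \<ominus>\<^bsub>F_rng tri\<^esub> ?v \<in> a_kernel (F_rng tri) End_ring (rho_F tri)"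
    unfolding a_kernel_def' using F.minus_closed[OF pure_tensor_carrier pure_tensor_carrier] by blast
qed

sublocale O: rng "O_rng tri"
  unfolding O_rng_def by (rule F.rng_Quot) (rule rng_ideal_J)

lemma rho_hom: "rho tri \<in> rng_hom (O_rng tri) End_ring"
proof -
  have "rho tri = (\<lambda>U. the_elem (rho_F tri ` U))"
    by (rule ext) (simp add: rho_def)
  then show ?thesis
    unfolding O_rng_def
    using F.the_elem_image_rng_hom[OF End.rng rho_F_hom rng_ideal_J J_ideal_kernel] by simp
qed

section \<open>The unital ring and its square-zero kernel\<close>

lemma A_ring_eq_dorroh: "A_ring tri = dorroh (O_rng tri)"
  by (simp add: A_ring_def dorroh_def)

lemma ring_A_ring: "ring (A_ring tri)"
  unfolding A_ring_eq_dorroh by (rule O.ring_dorroh)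

lemma rho_hat_hom: "rho_hat tri \<in> ring_hom (A_ring tri) End_ring"
  unfolding A_ring_eq_dorroh rho_hat_def by (rule O.dorroh_ring_hom[OF ring_End_ring rho_hom])

lemma square_zero_extension_A_ring:
  assumes "ideal_prod (A_ring tri) (defect tri) (defect tri) = {\<zero>\<^bsub>A_ring tri\<^esub>}"
  shows "square_zero_extension (A_ring tri) (R_ring tri) (rho_hat tri)"
proof -
  interpret h: ring_hom_ring "A_ring tri" End_ring "rho_hat tri"
    by (intro ring_hom_ringI2 ring_A_ring ring_End_ring rho_hat_hom)
  let ?A = "A_ring tri" and ?R = "R_ring tri"
  show ?thesis
  proof (intro square_zero_extension.intro square_zero_extension_axioms.intro ring_A_ring)
    show "ring ?R"
      unfolding R_ring_def by (rule h.img_is_ring)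
    show "rho_hat tri ` carrier ?A = carrier ?R"
      by (simp add: R_ring_def)
    then show "rho_hat tri \<in> ring_hom ?A ?R"
      using ring_hom_memE[OF rho_hat_hom] by (intro ring_hom_memI) (auto simp: R_ring_def)
    show "k \<otimes>\<^bsub>?A\<^esub> l = \<zero>\<^bsub>?A\<^esub>"
      if "k \<in> a_kernel ?A ?R (rho_hat tri)" "l \<in> a_kernel ?A ?R (rho_hat tri)" for k l
      \<comment> \<open>Each product \<open>k l\<close> belongs to the ideal product, which is zero
        by assumption.\<close>
      using ideal_prod.prod[OF that[folded defect_eq_kernel], of ?A] unfolding assms by (rule singletonD)
  qed
qed

end

section \<open>Transfer from general square-zero extensions to the regular defect\<close>

lemma defect_bimodule_eq: "defect_bimodule tri = lift_bimodule (A_ring tri) (R_ring tri) (rho_hat tri)"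
  unfolding defect_bimodule_def lift_bimodule_def defect_eq_kernel ..

lemma unital_additive_section_eq:
  "unital_additive_section tri = additive_section (A_ring tri) (R_ring tri) (rho_hat tri)"
  by (intro ext) (simp only: unital_additive_section_def additive_section_def)

lemma unital_ring_section_eq:
  "unital_ring_section tri = ring_section (A_ring tri) (R_ring tri) (rho_hat tri)"
  by (intro ext) (simp only: unital_ring_section_def ring_section_def)

lemma omega_eq: "omega tri = factor_set (A_ring tri) (R_ring tri)"
  by (intro ext) (simp only: omega_def factor_set_def)

theorem theorem10p1:
  fixes tri :: "('t::ab_group_add, 'g::ab_group_add) ternary"
  assumes "ternary_gamma_ring tri"
    and "ideal_prod (A_ring tri) (defect tri) (defect tri) = {\<zero>\<^bsub>A_ring tri\<^esub>}"
    and "\<exists>s. unital_additive_section tri s"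
  shows "(\<forall>s. unital_additive_section tri s \<longrightarrow>
            omega tri s \<in> cocycles (R_ring tri) (defect_bimodule tri) 2 \<and>
            normalized (R_ring tri) (defect_bimodule tri) 2 (omega tri s))
    \<and> (\<forall>s s'. unital_additive_section tri s \<longrightarrow> unital_additive_section tri s' \<longrightarrow>
            HH_class (R_ring tri) (defect_bimodule tri) 2 (omega tri s)
              = HH_class (R_ring tri) (defect_bimodule tri) 2 (omega tri s'))
    \<and> (Omega tri = \<one>\<^bsub>HH (R_ring tri) (defect_bimodule tri) 2\<^esub>
         \<longleftrightarrow> (\<exists>s. unital_ring_section tri s))
    \<and> ((\<exists>s. unital_ring_section tri s)
         \<longleftrightarrow> equivalent_extensions (defect tri)
              (A_ring tri, \<lambda>k. k, rho_hat tri)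
              (split_extension (R_ring tri) (defect_bimodule tri), \<lambda>k. (\<zero>\<^bsub>R_ring tri\<^esub>, k), fst))"
proof -
  interpret ternary_gamma_ring tri by fact
  interpret square_zero_extension "A_ring tri" "R_ring tri" "rho_hat tri"
    using assms(2) by (rule square_zero_extension_A_ring)
  obtain s where s: "additive_section (A_ring tri) (R_ring tri) (rho_hat tri) s"
    using assms(3) unfolding unital_additive_section_eq ..
  \<comment> \<open>The description in \<open>Omega\<close> is met by the class of \<open>s\<close>,
    and by no other class because of independence.\<close>
  have "Omega tri = HH_class (R_ring tri) M 2 (factor_set (A_ring tri) (R_ring tri) s)"
    unfolding Omega_def unital_additive_section_eq defect_bimodule_eq omega_eq
    using s HH_class_factor_set_unique by (intro the_equality) blast+
  then have "Omega tri = \<one>\<^bsub>HH (R_ring tri) M 2\<^esub> \<longleftrightarrow>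
      (\<exists>t. ring_section (A_ring tri) (R_ring tri) (rho_hat tri) t)"
    using HH_class_factor_set_trivial_iff[OF s] by simp
  then show ?thesis
    \<comment> \<open>Unfolded, equivalence with the split extension is the right side of
      \<open>ring_section_iff_split\<close>.\<close>
    unfolding unital_additive_section_eq unital_ring_section_eq omega_eq defect_bimodule_eq
      defect_eq_kernel equivalent_extensions_def prod.case
    using factor_set_cocycle factor_set_normalized HH_class_factor_set_unique ring_section_iff_split
    by blast
qed

end
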